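(* Let $n_x\ge 1$, $A\in\mathbb{R}^{n_x\times n_x}$, $B\in\mathbb{R}^{n_x\times 1}$, $C\in\mathbb{R}^{1\times n_x}$, $\lambda\in\mathbb{R}$, $\nu>0$, $\theta_i>0$, $\theta_o\in[0,\theta_i]$, and consider the system $$\dot x(t)=Ax(t)+B\,\partial_\theta z(t,\theta_o),\qquad \partial_t z(t,\theta)=(\nu\partial_{\theta\theta}+\lambda)z(t,\theta)\ \ (\theta\in(0,\theta_i)),\qquad z(t,0)=Cx(t),\quad z(t,\theta_i)=0,\qquad t\ge0.$$ Let $n\in\mathbb{N}$ and let $\{\varphi_k\}_{k\in\{0,\dots,n-1\}}\subset L^2(0,\theta_i)$ be linearly independent functions, orthonormal for the usual $L^2(0,\theta_i)$ scalar product and closed under differentiation; put $\Phi_n=(\varphi_0,\dots,\varphi_{n-1})^\top$ and let $\Delta_n\in\mathbb{R}^{n\times n}$ be such that $\Phi_n'(\theta)=\Delta_n\Phi_n(\theta)$ for all $\theta\in[0,\theta_i]$. For $(P,Q_n,T_n)$ define $$\Psi_n^+=\begin{bmatrix}P&Q_n\\Q_n^\top&T_n\end{bmatrix},\qquad \Psi_n^-=\mathrm{He}\left(\begin{bmatrix}\Psi_{xx}&\Psi_{xz}\\0&\Psi_{zz}\end{bmatrix}\right),$$ $$\Psi_{xx}=PA,\qquad \Psi_{xz}=PB\Phi_n^\top(\theta_o)\Delta_n^\top+(\lambda I_{n_x}+A^\top)Q_n+\nu Q_n(\Delta_n^\top)^2,$$ $$\Psi_{zz}=\Delta_n\Phi_n(\theta_o)B^\top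 Q_n+T_n\big(\lambda I_n+\nu(\Delta_n^\top)^2\big),$$ and let $\Pi_n$ be a matrix whose columns form a basis of the kernel of $\begin{bmatrix}C&-\Phi_n^\top(0)\\0&-\Phi_n^\top(\theta_i)\end{bmatrix}$. If there is no triplet of matrices $(P,Q_n,T_n)\in\mathbb{S}^{n_x}_+\times\mathbb{R}^{n_x\times n}\times\mathbb{S}^n_+$ such that $\Psi_n^+\succ0$ and $\Pi_n^\top\Psi_n^-\Pi_n\prec0$, then the system is unstable.
   Context: $\mathbb{S}^m_+$ is the set of symmetric positive definite real $m\times m$ matrices; $M\succ0$ (resp. $M\prec 0$) means that $M$ is symmetric positive (resp. negative) definite; $\mathrm{He}(M)=M+M^\top$. State space: $\mathcal{H}=\mathbb{R}^{n_x}\times L^2(0,\theta_i)$ with norm $\|(x,z)\|^2=|x|^2+\int_0^{\theta_i}|z(\theta)|^2\,d\theta$. The operator associated with the system is $\mathcal{A}(x,z)=(Ax+B\,\partial_\theta z(\theta_o),\ \nu\partial_{\theta\theta}z+\lambda z)$ on the domain $\mathcal{D}=\{(x,z)\in\mathbb{R}^{n_x}\times H^2(0,\theta_i): z(0)=Cx,\ z(\theta_i)=0\}$. The solution with initial condition $(x_0,z_0)\in\mathcal{H}$ is $(x(t),z(t))=\mathcal{T}(t)(x_0,z_0)$, where $\mathcal{T}$ is the semigroup on $\mathcal{H}$ generated by $\mathcal{A}$. Global asymptotic stability means: (i) for all $\varepsilon>0$ there exists $\delta>0$ such that for any $(x_0,z_0)$ with $\|(x_0,z_0)\|\le\delta$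 one has $\|(x(t),z(t))\|\le\varepsilon$ for all $t\ge 0$; and (ii) for any $(x_0,z_0)\in\mathcal{H}$ the solution $(x(t),z(t))\in\mathcal{H}$ converges to the origin as $t\to\infty$. "Unstable" means not globally asymptotically stable. *)

theory Defs
  imports "HOL-Analysis.Analysis" "Jordan_Normal_Form.Matrix_Kernel"
begin

definition pos_def_mat :: "nat \<Rightarrow> real Matrix.mat \<Rightarrow> bool" where
  "pos_def_mat m M \<longleftrightarrow> M \<in> carrier_mat m m \<and> transpose_mat M = M \<and>
     (\<forall>v\<in>carrier_vec m. v \<noteq> 0\<^sub>v m \<longrightarrow> scalar_prod v (M *\<^sub>v v) > 0)"

definition neg_def_mat :: "nat \<Rightarrow> real Matrix.mat \<Rightarrow> bool" where
  "neg_def_mat m M \<longleftrightarrow> M \<in> carrier_mat m m \<and> transpose_mat M = M \<and>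
     (\<forall>v\<in>carrier_vec m. v \<noteq> 0\<^sub>v m \<longrightarrow> scalar_prod v (M *\<^sub>v v) < 0)"

definition He :: "real Matrix.mat \<Rightarrow> real Matrix.mat" where
  "He M = M + transpose_mat M"

definition kernel_basis_mat :: "nat \<Rightarrow> real Matrix.mat \<Rightarrow> real Matrix.mat \<Rightarrow> bool" where
  "kernel_basis_mat m K M \<longleftrightarrow> M \<in> carrier_mat m (dim_col M) \<and>
     distinct (cols M) \<and> kernel.basis m K (set (cols M))"

text \<open>
  Elements of $L^2(0,L)$ are represented by functions, and functions that agree almost everywhere
  on $(0,L)$ stand for the same element. All notions below respect this identification.
\<close>

definition L2 :: "real \<Rightarrow> (real \<Rightarrow> real) set" where
  "L2 L = {z. z \<in> borel_measurable (lebesgue_on {0<..<L}) \<and>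
              integrable (lebesgue_on {0<..<L}) (\<lambda>\<theta>. (z \<theta>)\<^sup>2)}"

definition L2_inner :: "real \<Rightarrow> (real \<Rightarrow> real) \<Rightarrow> (real \<Rightarrow> real) \<Rightarrow> real" where
  "L2_inner L z w = (LINT \<theta>|lebesgue_on {0<..<L}. z \<theta> * w \<theta>)"

definition L2_eq :: "real \<Rightarrow> (real \<Rightarrow> real) \<Rightarrow> (real \<Rightarrow> real) \<Rightarrow> bool" where
  "L2_eq L z w \<longleftrightarrow> (AE \<theta> in lebesgue_on {0<..<L}. z \<theta> = w \<theta>)"

definition L2_lin_indep :: "real \<Rightarrow> nat \<Rightarrow> (nat \<Rightarrow> real \<Rightarrow> real) \<Rightarrow> bool" where
  "L2_lin_indep L n \<phi> \<longleftrightarrow>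
     (\<forall>c :: nat \<Rightarrow> real. L2_eq L (\<lambda>\<theta>. \<Sum>k<n. c k * \<phi> k \<theta>) (\<lambda>_. 0) \<longrightarrow> (\<forall>k<n. c k = 0))"

definition L2_orthonormal :: "real \<Rightarrow> nat \<Rightarrow> (nat \<Rightarrow> real \<Rightarrow> real) \<Rightarrow> bool" where
  "L2_orthonormal L n \<phi> \<longleftrightarrow>
     (\<forall>j<n. \<forall>k<n. L2_inner L (\<phi> j) (\<phi> k) = (if j = k then 1 else 0))"

type_synonym state = "real Matrix.vec \<times> (real \<Rightarrow> real)"

definition Hspace :: "nat \<Rightarrow> real \<Rightarrow> state set" where
  "Hspace nx L = carrier_vec nx \<times> L2 L"

definition Hnorm :: "real \<Rightarrow> state \<Rightarrow> real" where
  "Hnorm L h = sqrt (scalar_prod (fst h) (fst h) + (LINT \<theta>|lebesgue_on {0<..<L}. \<bar>snd h \<theta>\<bar>\<^sup>2))"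

definition Hadd :: "state \<Rightarrow> state \<Rightarrow> state" where
  "Hadd h k = (fst h + fst k, \<lambda>\<theta>. snd h \<theta> + snd k \<theta>)"

definition Hscale :: "real \<Rightarrow> state \<Rightarrow> state" where
  "Hscale c h = (c \<cdot>\<^sub>v fst h, \<lambda>\<theta>. c * snd h \<theta>)"

definition Hdiff :: "state \<Rightarrow> state \<Rightarrow> state" where
  "Hdiff h k = (fst h - fst k, \<lambda>\<theta>. snd h \<theta> - snd k \<theta>)"

definition Heq :: "real \<Rightarrow> state \<Rightarrow> state \<Rightarrow> bool" where
  "Heq L h k \<longleftrightarrow> fst h = fst k \<and> L2_eq L (snd h) (snd k)"

definition test_function :: "real \<Rightarrow> (real \<Rightarrow> real) \<Rightarrow> bool" where
  "test_function L \<psi> \<longleftrightarrow>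
     (\<forall>k. (deriv ^^ k) \<psi> differentiable_on UNIV) \<and> closure {\<theta>. \<psi> \<theta> \<noteq> 0} \<subseteq> {0<..<L}"

definition weak_deriv :: "real \<Rightarrow> (real \<Rightarrow> real) \<Rightarrow> (real \<Rightarrow> real) \<Rightarrow> bool" where
  "weak_deriv L z w \<longleftrightarrow>
     (\<forall>\<psi>. test_function L \<psi> \<longrightarrow> L2_inner L z (deriv \<psi>) = - L2_inner L w \<psi>)"

text \<open>
  \<open>has_H2_derivs L z z1 z2\<close>: the function \<open>z\<close> lies in $H^2(0,L)$, with first and second
  weak derivatives \<open>z1\<close> and \<open>z2\<close>.
\<close>

definition has_H2_derivs ::
    "real \<Rightarrow> (real \<Rightarrow> real) \<Rightarrow> (real \<Rightarrow> real) \<Rightarrow> (real \<Rightarrow> real) \<Rightarrow> bool" where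
  "has_H2_derivs L z z1 z2 \<longleftrightarrow>
     z \<in> L2 L \<and> z1 \<in> L2 L \<and> z2 \<in> L2 L \<and> weak_deriv L z z1 \<and> weak_deriv L z1 z2"

text \<open>
  Point values of an element of $H^1(0,L)$, endpoints included, are those of its representative
  that is continuous on $[0,L]$; it exists by Sobolev embedding and is unique.
\<close>

definition has_value :: "real \<Rightarrow> (real \<Rightarrow> real) \<Rightarrow> real \<Rightarrow> real \<Rightarrow> bool" where
  "has_value L z \<theta> v \<longleftrightarrow> (\<exists>u. continuous_on {0..L} u \<and> L2_eq L u z \<and> u \<theta> = v)"

definition C0_semigroup :: "nat \<Rightarrow> real \<Rightarrow> (real \<Rightarrow> state \<Rightarrow> state) \<Rightarrow> bool" where
  "C0_semigroup nx L S \<longleftrightarrow>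
     (\<forall>t\<ge>0. \<forall>h\<in>Hspace nx L. S t h \<in> Hspace nx L) \<and>
     (\<forall>t\<ge>0. \<forall>h\<in>Hspace nx L. \<forall>k\<in>Hspace nx L. Heq L (S t (Hadd h k)) (Hadd (S t h) (S t k))) \<and>
     (\<forall>t\<ge>0. \<forall>c. \<forall>h\<in>Hspace nx L. Heq L (S t (Hscale c h)) (Hscale c (S t h))) \<and>
     (\<forall>t\<ge>0. \<exists>M. \<forall>h\<in>Hspace nx L. Hnorm L (S t h) \<le> M * Hnorm L h) \<and>
     (\<forall>h\<in>Hspace nx L. Heq L (S 0 h) h) \<and>
     (\<forall>s\<ge>0. \<forall>t\<ge>0. \<forall>h\<in>Hspace nx L. Heq L (S (s + t) h) (S s (S t h))) \<and>
     (\<forall>h\<in>Hspace nx L. ((\<lambda>t. Hnorm L (Hdiff (S t h) h)) \<longlongrightarrow> 0) (at_right 0))"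

text \<open>An operator is given by its graph, i.e. the set of pairs \<open>(h, g)\<close> with \<open>h\<close> in the domain and
  \<open>g\<close> the image of \<open>h\<close>.\<close>

definition generates :: "nat \<Rightarrow> real \<Rightarrow> (state \<times> state) set \<Rightarrow> (real \<Rightarrow> state \<Rightarrow> state) \<Rightarrow> bool" where
  "generates nx L G S \<longleftrightarrow> C0_semigroup nx L S \<and>
     (\<forall>h\<in>Hspace nx L. \<forall>g\<in>Hspace nx L. (h, g) \<in> G \<longleftrightarrow>
        ((\<lambda>t. Hnorm L (Hdiff (Hscale (1 / t) (Hdiff (S t h) h)) g)) \<longlongrightarrow> 0) (at_right 0))"

definition globally_asymptotically_stable ::
    "nat \<Rightarrow> real \<Rightarrow> (real \<Rightarrow> state \<Rightarrow> state) \<Rightarrow> bool" where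
  "globally_asymptotically_stable nx L S \<longleftrightarrow>
     (\<forall>\<epsilon>>0. \<exists>\<delta>>0. \<forall>h\<in>Hspace nx L. Hnorm L h \<le> \<delta> \<longrightarrow> (\<forall>t\<ge>0. Hnorm L (S t h) \<le> \<epsilon>)) \<and>
     (\<forall>h\<in>Hspace nx L. ((\<lambda>t. Hnorm L (S t h)) \<longlongrightarrow> 0) at_top)"

abbreviation unstable :: "nat \<Rightarrow> real \<Rightarrow> (real \<Rightarrow> state \<Rightarrow> state) \<Rightarrow> bool" where
  "unstable nx L S \<equiv> \<not> globally_asymptotically_stable nx L S"

text \<open>
  Graph of $(x,z) \mapsto (Ax + B\,\partial_\theta z(\theta_o),\ \nu\partial_{\theta\theta}z + \lambda z)$
  on its domain. The matrix \<open>B\<close> is a column, \<open>C\<close> a row.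
\<close>

definition system_operator ::
    "nat \<Rightarrow> real Matrix.mat \<Rightarrow> real Matrix.mat \<Rightarrow> real Matrix.mat \<Rightarrow> real \<Rightarrow> real \<Rightarrow> real \<Rightarrow> real
      \<Rightarrow> (state \<times> state) set" where
  "system_operator nx A B C lam \<nu> \<theta>i \<theta>o =
     {((x, z), (y, w)) | x z y w. x \<in> carrier_vec nx \<and> w \<in> L2 \<theta>i \<and>
        (\<exists>z1 z2 d. has_H2_derivs \<theta>i z z1 z2 \<and>
           has_value \<theta>i z 0 (vec_index (C *\<^sub>v x) 0) \<and> has_value \<theta>i z \<theta>i 0 \<and>
           has_value \<theta>i z1 \<theta>o d \<and>
           y = A *\<^sub>v x + d \<cdot>\<^sub>v Matrix.col B 0 \<and>
           L2_eq \<theta>i w (\<lambda>\<theta>. \<nu> * z2 \<theta> + lam * z \<theta>))}"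

definition Phi :: "nat \<Rightarrow> (nat \<Rightarrow> real \<Rightarrow> real) \<Rightarrow> real \<Rightarrow> real Matrix.mat" where
  "Phi n \<phi> \<theta> = Matrix.mat n 1 (\<lambda>(k, _). \<phi> k \<theta>)"

definition Psi_plus :: "real Matrix.mat \<Rightarrow> real Matrix.mat \<Rightarrow> real Matrix.mat \<Rightarrow> real Matrix.mat" where
  "Psi_plus P Q Tn = four_block_mat P Q (transpose_mat Q) Tn"

definition Psi_xx :: "real Matrix.mat \<Rightarrow> real Matrix.mat \<Rightarrow> real Matrix.mat" where
  "Psi_xx A P = P * A"

text \<open>In the next three definitions, \<open>\<Phi>o\<close> is the column $\Phi_n(\theta_o)$.\<close>

definition Psi_xz ::
    "nat \<Rightarrow> real Matrix.mat \<Rightarrow> real Matrix.mat \<Rightarrow> real \<Rightarrow> real \<Rightarrow> real Matrix.mat \<Rightarrow> real Matrix.mat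
      \<Rightarrow> real Matrix.mat \<Rightarrow> real Matrix.mat \<Rightarrow> real Matrix.mat" where
  "Psi_xz nx A B lam \<nu> \<Delta> \<Phi>o P Q =
     P * B * transpose_mat \<Phi>o * transpose_mat \<Delta>
     + (lam \<cdot>\<^sub>m 1\<^sub>m nx + transpose_mat A) * Q
     + \<nu> \<cdot>\<^sub>m (Q * (transpose_mat \<Delta> ^\<^sub>m 2))"

definition Psi_zz ::
    "nat \<Rightarrow> real Matrix.mat \<Rightarrow> real \<Rightarrow> real \<Rightarrow> real Matrix.mat \<Rightarrow> real Matrix.mat
      \<Rightarrow> real Matrix.mat \<Rightarrow> real Matrix.mat \<Rightarrow> real Matrix.mat" where
  "Psi_zz n B lam \<nu> \<Delta> \<Phi>o Q Tn =
     \<Delta> * \<Phi>o * transpose_mat B * Q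
     + Tn * (lam \<cdot>\<^sub>m 1\<^sub>m n + \<nu> \<cdot>\<^sub>m (transpose_mat \<Delta> ^\<^sub>m 2))"

definition Psi_minus ::
    "nat \<Rightarrow> nat \<Rightarrow> real Matrix.mat \<Rightarrow> real Matrix.mat \<Rightarrow> real \<Rightarrow> real \<Rightarrow> real Matrix.mat
      \<Rightarrow> real Matrix.mat \<Rightarrow> real Matrix.mat \<Rightarrow> real Matrix.mat \<Rightarrow> real Matrix.mat \<Rightarrow> real Matrix.mat" where
  "Psi_minus nx n A B lam \<nu> \<Delta> \<Phi>o P Q Tn =
     He (four_block_mat (Psi_xx A P) (Psi_xz nx A B lam \<nu> \<Delta> \<Phi>o P Q)
                        (0\<^sub>m n nx) (Psi_zz n B lam \<nu> \<Delta> \<Phi>o Q Tn))"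

definition boundary_mat ::
    "nat \<Rightarrow> real Matrix.mat \<Rightarrow> real Matrix.mat \<Rightarrow> real Matrix.mat \<Rightarrow> real Matrix.mat" where
  "boundary_mat nx C \<Phi>0 \<Phi>i =
     four_block_mat C (- transpose_mat \<Phi>0) (0\<^sub>m 1 nx) (- transpose_mat \<Phi>i)"

end

theory Submission
  imports Defs "Jordan_Normal_Form.DL_Rank"
begin

text \<open>
  The proof is by contraposition: a globally asymptotically stable system provides a triplet. Write
  $S(t)$ for the semigroup and $\|\cdot\|$ for the norm of the state space. The vectors
  $v = (x, \zeta)$ with $x \in \mathbb{R}^{n_x}$ and $\zeta \in \mathbb{R}^n$ are mapped to the states
  $Ev = (x, \Phi_n^\top \zeta)$, and $E$ is isometric since the $\varphi_k$ are orthonormal.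

  For $T > 0$ consider the symmetric matrix $V$ with
  \[ v^\top V w = \int_0^T \langle S(t) E v, S(t) E w \rangle \, dt . \]
  It is positive definite, because $\|S(t) E v\|$ is continuous in $t$ and is nonzero at $t = 0$ when
  $v \neq 0$. Its blocks are the matrices $P$, $Q_n$ and $T_n$. If $E v$ lies in the domain of the
  generator and its image is $E w$, then $\frac{d}{dt} \|S(t) E v\|^2 = 2 \langle S(t) E v, S(t) E w
  \rangle$, so that
  \[ 2 v^\top V w = \|S(T) E v\|^2 - \|E v\|^2 . \]
  Stability bounds $S(t)$ uniformly in $t \ge 0$, and attractivity makes $S(T) E v$ converge to $0$ for
  each $v$; as the space of the $v$ has finite dimension, one $T$ satisfies $\|S(T) E v\| < \|E v\|$ for
  all $v \neq 0$. With this $T$ the right-hand side is negative. Integrating over $[0,T]$ instead of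
  $[0,\infty)$ makes any decay rate of the semigroup unnecessary.

  Since the $\varphi_k$ are closed under differentiation, $E v$ is in the domain as soon as $v$ satisfies the
  boundary conditions, i.e. lies in the kernel spanned by the columns of $\Pi_n$, and then its image is $E w$ for
  \[ w = (Ax + B \Phi_n(\theta_o)^\top \Delta_n^\top \zeta,\ \lambda \zeta + \nu (\Delta_n^\top)^2 \zeta) . \]
  For this $w$ one has $v^\top \Psi_n^- v = 2 v^\top V w$, so $\Pi_n^\top \Psi_n^- \Pi_n$ is negative
  definite.

  The steps are the lemmas \<open>eventually_contractive\<close>, \<open>energy_mat_pos_def\<close>, \<open>energy_mat_derivative\<close>,
  \<open>Psi_minus_quadratic_form\<close> and \<open>mode_state_in_domain\<close>.
\<close>

section \<open>The inner product of the state space\<close>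

text \<open>
  The inner product that induces \<open>Hnorm\<close>. It depends only on the classes of its arguments modulo
  \<open>Heq\<close> (lemma \<open>Hinner_cong\<close>), so identities that hold up to \<open>Heq\<close> turn into equations between
  real numbers.
\<close>

definition Hinner :: "real \<Rightarrow> state \<Rightarrow> state \<Rightarrow> real" where
  "Hinner L h k = scalar_prod (fst h) (fst k) + L2_inner L (snd h) (snd k)"

lemma L2_prod_integrable:
  assumes "z \<in> L2 L" "w \<in> L2 L"
  shows "integrable (lebesgue_on {0<..<L}) (\<lambda>\<theta>. z \<theta> * w \<theta>)"
proof (rule Bochner_Integration.integrable_bound)
  show "integrable (lebesgue_on {0<..<L}) (\<lambda>\<theta>. (z \<theta>)\<^sup>2 + (w \<theta>)\<^sup>2)"
    using assms by (auto simp: L2_def)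
  show "(\<lambda>\<theta>. z \<theta> * w \<theta>) \<in> borel_measurable (lebesgue_on {0<..<L})"
    using assms by (auto simp: L2_def)
  have "\<bar>a * b\<bar> \<le> a\<^sup>2 + b\<^sup>2" for a b :: real
  proof -
    have "2 * \<bar>a\<bar> * \<bar>b\<bar> \<le> a\<^sup>2 + b\<^sup>2" "0 \<le> \<bar>a\<bar> * \<bar>b\<bar>"
      using sum_squares_bound[of "\<bar>a\<bar>" "\<bar>b\<bar>"] by simp_all
    then show ?thesis unfolding abs_mult by linarith
  qed
  then show "AE \<theta> in lebesgue_on {0<..<L}. norm (z \<theta> * w \<theta>) \<le> norm ((z \<theta>)\<^sup>2 + (w \<theta>)\<^sup>2)"
    by auto
qed

lemma L2_add:
  assumes "z \<in> L2 L" "w \<in> L2 L"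
  shows "(\<lambda>\<theta>. z \<theta> + w \<theta>) \<in> L2 L"
proof -
  have "integrable (lebesgue_on {0<..<L}) (\<lambda>\<theta>. (z \<theta>)\<^sup>2 + (w \<theta>)\<^sup>2 + 2 * (z \<theta> * w \<theta>))"
    using assms L2_prod_integrable[OF assms] by (intro Bochner_Integration.integrable_add
        Bochner_Integration.integrable_mult_right) (auto simp: L2_def)
  then show ?thesis using assms by (auto simp: L2_def power2_sum mult.assoc)
qed

lemma L2_scale: "z \<in> L2 L \<Longrightarrow> (\<lambda>\<theta>. c * z \<theta>) \<in> L2 L"
  by (auto simp: L2_def power_mult_distrib)

lemma L2_zero: "(\<lambda>\<theta>. 0) \<in> L2 L"
  by (auto simp: L2_def)

lemma L2_sum:
  "(\<And>k. k < (n::nat) \<Longrightarrow> f k \<in> L2 L) \<Longrightarrow> (\<lambda>\<theta>. \<Sum>k<n. c k * f k \<theta>) \<in> L2 L"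
  by (induction n) (auto intro!: L2_add L2_scale L2_zero)

lemma Hadd_closed: "h \<in> Hspace nx L \<Longrightarrow> k \<in> Hspace nx L \<Longrightarrow> Hadd h k \<in> Hspace nx L"
  by (auto simp: Hspace_def Hadd_def mem_Times_iff L2_add)

lemma Hscale_closed: "h \<in> Hspace nx L \<Longrightarrow> Hscale c h \<in> Hspace nx L"
  by (auto simp: Hspace_def Hscale_def mem_Times_iff L2_scale)

lemma Hdiff_eq_Hadd:
  assumes "h \<in> Hspace nx L" "k \<in> Hspace nx L"
  shows "Hdiff h k = Hadd h (Hscale (-1) k)"
  using assms by (auto simp: Hspace_def Hdiff_def Hadd_def Hscale_def mem_Times_iff
      intro!: eq_vecI)

lemma Hdiff_closed: "h \<in> Hspace nx L \<Longrightarrow> k \<in> Hspace nx L \<Longrightarrow> Hdiff h k \<in> Hspace nx L"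
  by (metis Hdiff_eq_Hadd Hadd_closed Hscale_closed)

lemma Hinner_commute:
  assumes "h \<in> Hspace nx L" "k \<in> Hspace nx L"
  shows "Hinner L h k = Hinner L k h"
proof -
  have "scalar_prod (fst h) (fst k) = scalar_prod (fst k) (fst h)"
    using assms by (intro comm_scalar_prod[of _ nx]) (auto simp: Hspace_def)
  then show ?thesis by (simp add: Hinner_def L2_inner_def mult.commute)
qed

lemma Hinner_add_left:
  assumes "h \<in> Hspace nx L" "k \<in> Hspace nx L" "l \<in> Hspace nx L"
  shows "Hinner L (Hadd h k) l = Hinner L h l + Hinner L k l"
proof -
  have "scalar_prod (fst h + fst k) (fst l) = scalar_prod (fst h) (fst l) + scalar_prod (fst k) (fst l)"
    using assms by (intro add_scalar_prod_distrib[of _ nx]) (auto simp: Hspace_def)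
  moreover have "L2_inner L (\<lambda>\<theta>. snd h \<theta> + snd k \<theta>) (snd l)
      = L2_inner L (snd h) (snd l) + L2_inner L (snd k) (snd l)"
    unfolding L2_inner_def distrib_right using assms
    by (intro Bochner_Integration.integral_add L2_prod_integrable) (auto simp: Hspace_def)
  ultimately show ?thesis by (simp add: Hinner_def Hadd_def)
qed

lemma Hinner_scale_left:
  assumes "h \<in> Hspace nx L" "l \<in> Hspace nx L"
  shows "Hinner L (Hscale c h) l = c * Hinner L h l"
proof -
  have "scalar_prod (c \<cdot>\<^sub>v fst h) (fst l) = c * scalar_prod (fst h) (fst l)"
    using assms by (intro smult_scalar_prod_distrib[of _ nx]) (auto simp: Hspace_def)
  then show ?thesis by (simp add: Hinner_def Hscale_def L2_inner_def distrib_left mult.assoc)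
qed

lemma Hinner_self: "Hinner L h h = scalar_prod (fst h) (fst h)
    + (LINT \<theta>|lebesgue_on {0<..<L}. \<bar>snd h \<theta>\<bar>\<^sup>2)"
  by (simp add: Hinner_def L2_inner_def power2_eq_square)

lemma Hinner_nonneg: "0 \<le> Hinner L h h"
  unfolding Hinner_self by (auto intro!: add_nonneg_nonneg sum_nonneg simp: scalar_prod_def)

lemma Hnorm_eq: "Hnorm L h = sqrt (Hinner L h h)"
  by (simp add: Hinner_self Hnorm_def)

lemma Hnorm_nonneg [simp]: "0 \<le> Hnorm L h"
  by (simp add: Hnorm_eq Hinner_nonneg)

lemma Hnorm_square: "(Hnorm L h)\<^sup>2 = Hinner L h h"
  by (simp add: Hnorm_eq Hinner_nonneg)

lemma Hinner_cong:
  assumes "Heq L h h'" "Heq L k k'"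
    and "h \<in> Hspace nx L" "h' \<in> Hspace nx L" "k \<in> Hspace nx L" "k' \<in> Hspace nx L"
  shows "Hinner L h k = Hinner L h' k'"
proof -
  have "L2_inner L (snd h) (snd k) = L2_inner L (snd h') (snd k')"
    unfolding L2_inner_def
  proof (rule integral_cong_AE)
    show "AE \<theta> in lebesgue_on {0<..<L}. snd h \<theta> * snd k \<theta> = snd h' \<theta> * snd k' \<theta>"
      using assms unfolding Heq_def L2_eq_def by auto
  qed (use assms in \<open>auto simp: Hspace_def L2_def\<close>)
  then show ?thesis using assms by (simp add: Hinner_def Heq_def)
qed

lemma Hnorm_cong:
  "Heq L h k \<Longrightarrow> h \<in> Hspace nx L \<Longrightarrow> k \<in> Hspace nx L \<Longrightarrow> Hnorm L h = Hnorm L k"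
  unfolding Hnorm_eq using Hinner_cong by metis

lemma Hnorm_scale:
  assumes "h \<in> Hspace nx L"
  shows "Hnorm L (Hscale c h) = \<bar>c\<bar> * Hnorm L h"
proof -
  note H = assms Hscale_closed[OF assms]
  have "Hinner L (Hscale c h) (Hscale c h) = c\<^sup>2 * Hinner L h h"
    using H Hinner_scale_left[of h nx L "Hscale c h" c] Hinner_scale_left[of h nx L h c]
      Hinner_commute[of h nx L "Hscale c h"]
    by (simp add: power2_eq_square)
  then show ?thesis by (simp add: Hnorm_eq real_sqrt_mult)
qed

text \<open>The Cauchy--Schwarz inequality.\<close>

lemma Hinner_le:
  assumes h: "h \<in> Hspace nx L" and k: "k \<in> Hspace nx L"
  shows "\<bar>Hinner L h k\<bar> \<le> Hnorm L h * Hnorm L k"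
proof -
  define a c b where "a = Hinner L h h" and "c = Hinner L k k" and "b = Hinner L h k"
  \<comment> \<open>the square of the norm of \<open>s h + r k\<close>\<close>
  have pos: "0 \<le> a * s\<^sup>2 + 2 * s * r * b + c * r\<^sup>2" for s r
  proof -
    let ?u = "Hscale s h" and ?v = "Hscale r k"
    note cl = h k Hscale_closed[OF h, of s] Hscale_closed[OF k, of r]
    note cl2 = cl Hadd_closed[OF cl(3,4)]
    have "0 \<le> Hinner L (Hadd ?u ?v) (Hadd ?u ?v)" by (rule Hinner_nonneg)
    also have "\<dots> = Hinner L ?u (Hadd ?u ?v) + Hinner L ?v (Hadd ?u ?v)"
      using cl2 Hinner_add_left by blast
    also have "\<dots> = s * Hinner L (Hadd ?u ?v) h + r * Hinner L (Hadd ?u ?v) k"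
      using cl2 by (simp add: Hinner_scale_left Hinner_commute[where h="Hadd ?u ?v" and nx=nx])
    also have "\<dots> = a * s\<^sup>2 + 2 * s * r * b + c * r\<^sup>2"
      using cl2 by (simp add: Hinner_scale_left Hinner_add_left Hinner_commute[of k nx L h]
          a_def b_def c_def power2_eq_square algebra_simps)
    finally show ?thesis .
  qed
  have ac: "a \<ge> 0" "c \<ge> 0" unfolding a_def c_def by (rule Hinner_nonneg)+
  have "b\<^sup>2 \<le> a * c"
  proof (cases "a = 0")
    case True
    have "b = 0"
    proof (rule ccontr)
      assume b: "b \<noteq> 0"
      \<comment> \<open>for this \<open>s\<close> the form takes the value \<open>-1\<close>\<close>
      have "0 \<le> 2 * (-(c+1) / (2*b)) * b + c"
        using pos[of "-(c+1)/(2*b)" 1] True by simp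
      then show False using b by (simp add: field_simps)
    qed
    then show ?thesis using ac by simp
  next
    case False
    have "0 \<le> a * b\<^sup>2 + 2 * b * (-a) * b + c * a\<^sup>2"
      using pos[of b "-a"] by simp
    then have "0 \<le> a * (a * c - b\<^sup>2)" by (simp add: power2_eq_square algebra_simps)
    then show ?thesis using False ac by (simp add: zero_le_mult_iff)
  qed
  then have "sqrt (b\<^sup>2) \<le> sqrt (a * c)" by (rule real_sqrt_le_mono)
  then show ?thesis by (simp add: Hnorm_eq a_def b_def c_def real_sqrt_mult)
qed

section \<open>Uniform one-sided difference quotients\<close>

lemma tendsto_at_right_0_abs_diff:
  fixes r :: "real \<Rightarrow> real"
  assumes "(r \<longlongrightarrow> 0) (at_right 0)"
  shows "((\<lambda>y. r \<bar>y - t\<bar>) \<longlongrightarrow> 0) (at t within S)"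
proof (rule filterlim_compose[OF assms])
  have "((\<lambda>y. \<bar>y - t\<bar>) \<longlongrightarrow> \<bar>t - t\<bar>) (at t within S)" by (intro tendsto_intros)
  moreover have "\<forall>\<^sub>F y in at t within S. \<bar>y - t\<bar> \<in> {0<..} \<and> \<bar>y - t\<bar> \<noteq> 0"
    unfolding eventually_at_filter by (auto intro: always_eventually)
  ultimately show "filterlim (\<lambda>y. \<bar>y - t\<bar>) (at_right 0) (at t within S)"
    unfolding filterlim_at by simp
qed

text \<open>
  A modulus of right-continuity that does not depend on the point yields two-sided continuity:
  left-continuity at \<open>t\<close> is right-continuity at the points before \<open>t\<close>.
\<close>

lemma continuous_on_uniform_right:
  fixes f r :: "real \<Rightarrow> real"
  assumes r: "(r \<longlongrightarrow> 0) (at_right 0)"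
    and f: "\<And>t s. 0 \<le> t \<Longrightarrow> 0 < s \<Longrightarrow> \<bar>f (t + s) - f t\<bar> \<le> r s"
  shows "continuous_on {0..} f"
  unfolding continuous_on_def
proof
  fix t :: real assume t: "t \<in> {0..}"
  have le: "\<bar>f y - f t\<bar> \<le> r \<bar>y - t\<bar>" if "y \<ge> 0" "y \<noteq> t" for y
    using f[of t "y - t"] f[of y "t - y"] t that by (cases "y > t") (auto simp: abs_minus_commute)
  have "((\<lambda>y. f y - f t) \<longlongrightarrow> 0) (at t within {0..})"
    by (rule Lim_null_comparison[OF _ tendsto_at_right_0_abs_diff[OF r]])
       (auto simp: eventually_at_filter le intro!: always_eventually)
  then show "(f \<longlongrightarrow> f t) (at t within {0..})" by (simp add: LIM_zero_iff)
qed

text \<open>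
  For the same reason, a function whose right difference quotients converge uniformly to a continuous
  function \<open>q\<close> is an antiderivative of \<open>q\<close>.
\<close>

lemma has_integral_uniform_right_derivative:
  fixes f q r :: "real \<Rightarrow> real"
  assumes r: "(r \<longlongrightarrow> 0) (at_right 0)"
    and f: "\<And>t s. 0 \<le> t \<Longrightarrow> 0 < s \<Longrightarrow> \<bar>f (t + s) - f t - s * q t\<bar> \<le> s * r s"
    and q: "continuous_on {0..} q" and T: "0 \<le> T"
  shows "(q has_integral (f T - f 0)) {0..T}"
proof (rule fundamental_theorem_of_calculus[OF T])
  fix t assume t: "t \<in> {0..T}"
  have le: "\<bar>(f y - f t) / (y - t) - q t\<bar> \<le> r \<bar>y - t\<bar> + \<bar>q y - q t\<bar>" if y: "y \<ge> 0" "y \<noteq> t" for y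
  proof (cases "y > t")
    case True
    have "(f y - f t) / (y - t) - q t = (f y - f t - (y - t) * q t) / (y - t)"
      using True by (simp add: field_simps)
    then have "\<bar>(f y - f t) / (y - t) - q t\<bar> = \<bar>f y - f t - (y - t) * q t\<bar> / (y - t)"
      using True by (simp add: abs_divide)
    also have "\<dots> \<le> r \<bar>y - t\<bar>"
      using f[of t "y - t"] t True by (simp add: divide_le_eq mult.commute)
    finally show ?thesis by simp
  next
    case False
    then have lt: "y < t" using y by simp
    have "(f y - f t) / (y - t) - q y = (f t - f y - (t - y) * q y) / (t - y)"
      using lt by (simp add: field_simps)
    then have "\<bar>(f y - f t) / (y - t) - q y\<bar> = \<bar>f t - f y - (t - y) * q y\<bar> / (t - y)"
      using lt by (simp add: abs_divide)
    also have "\<dots> \<le> r \<bar>y - t\<bar>"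
      using f[of y "t - y"] y lt by (simp add: divide_le_eq mult.commute)
    finally show ?thesis by linarith
  qed
  have "((\<lambda>y. \<bar>q y - q t\<bar>) \<longlongrightarrow> \<bar>q t - q t\<bar>) (at t within {0..T})"
    using continuous_on_subset[OF q, of "{0..T}"] t
    by (intro tendsto_intros) (auto simp: continuous_on_def)
  then have lim: "((\<lambda>y. r \<bar>y - t\<bar> + \<bar>q y - q t\<bar>) \<longlongrightarrow> 0) (at t within {0..T})"
    using tendsto_add[OF tendsto_at_right_0_abs_diff[OF r, of t "{0..T}"]] by force
  have "((\<lambda>y. (f y - f t) / (y - t) - q t) \<longlongrightarrow> 0) (at t within {0..T})"
    by (rule Lim_null_comparison[OF _ lim])
       (auto simp: eventually_at_filter le intro!: always_eventually)
  then have "(f has_real_derivative q t) (at t within {0..T})"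
    by (simp add: LIM_zero_iff has_field_derivative_iff)
  then show "(f has_vector_derivative q t) (at t within {0..T})"
    by (simp add: has_real_derivative_iff_has_vector_derivative)
qed

section \<open>Uniformly bounded semigroups\<close>

lemma C0_semigroupD:
  assumes "C0_semigroup nx L S"
  shows C0_closed: "0 \<le> t \<Longrightarrow> h \<in> Hspace nx L \<Longrightarrow> S t h \<in> Hspace nx L"
    and C0_add: "0 \<le> t \<Longrightarrow> h \<in> Hspace nx L \<Longrightarrow> k \<in> Hspace nx L \<Longrightarrow>
      Heq L (S t (Hadd h k)) (Hadd (S t h) (S t k))"
    and C0_scale: "0 \<le> t \<Longrightarrow> h \<in> Hspace nx L \<Longrightarrow> Heq L (S t (Hscale c h)) (Hscale c (S t h))"
    and C0_bounded: "0 \<le> t \<Longrightarrow> \<exists>M. \<forall>h\<in>Hspace nx L. Hnorm L (S t h) \<le> M * Hnorm L h"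
    and C0_zero: "h \<in> Hspace nx L \<Longrightarrow> Heq L (S 0 h) h"
    and C0_compose: "0 \<le> s \<Longrightarrow> 0 \<le> t \<Longrightarrow> h \<in> Hspace nx L \<Longrightarrow> Heq L (S (s + t) h) (S s (S t h))"
    and C0_continuous:
      "h \<in> Hspace nx L \<Longrightarrow> ((\<lambda>t. Hnorm L (Hdiff (S t h) h)) \<longlongrightarrow> 0) (at_right 0)"
  using assms unfolding C0_semigroup_def by (elim conjE; simp)+

text \<open>A strongly continuous semigroup with a bound that is uniform in \<open>t \<ge> 0\<close>.\<close>

locale bounded_semigroup =
  fixes nx :: nat and L :: real and S :: "real \<Rightarrow> state \<Rightarrow> state" and M :: real
  assumes C0: "C0_semigroup nx L S"
    and bound: "\<And>t h. 0 \<le> t \<Longrightarrow> h \<in> Hspace nx L \<Longrightarrow> Hnorm L (S t h) \<le> M * Hnorm L h"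
begin

text \<open>
  The form $\langle S(t) h, S(t) k \rangle$. It is bilinear in \<open>h\<close> and \<open>k\<close>, since the linearity of
  $S(t)$ up to \<open>Heq\<close> is all that the inner product can see.
\<close>

definition gram :: "real \<Rightarrow> state \<Rightarrow> state \<Rightarrow> real" where
  "gram t h k = Hinner L (S t h) (S t k)"

lemma closed: "0 \<le> t \<Longrightarrow> h \<in> Hspace nx L \<Longrightarrow> S t h \<in> Hspace nx L"
  by (rule C0_closed[OF C0])

lemma gram_commute:
  "0 \<le> t \<Longrightarrow> h \<in> Hspace nx L \<Longrightarrow> k \<in> Hspace nx L \<Longrightarrow> gram t h k = gram t k h"
  unfolding gram_def by (intro Hinner_commute[where nx=nx] closed)

lemma gram_self: "gram t h h = (Hnorm L (S t h))\<^sup>2"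
  by (simp add: gram_def Hnorm_square)

lemma gram_add_left:
  assumes "0 \<le> t" "h \<in> Hspace nx L" "k \<in> Hspace nx L" "l \<in> Hspace nx L"
  shows "gram t (Hadd h k) l = gram t h l + gram t k l"
proof -
  have "Heq L (S t (Hadd h k)) (Hadd (S t h) (S t k))"
    using C0_add[OF C0] assms by simp
  then have "gram t (Hadd h k) l = Hinner L (Hadd (S t h) (S t k)) (S t l)"
    unfolding gram_def using assms
    by (intro Hinner_cong[where nx=nx]) (auto intro: closed Hadd_closed simp: Heq_def L2_eq_def)
  then show ?thesis using assms by (simp add: gram_def Hinner_add_left[where nx=nx] closed)
qed

lemma gram_scale_left:
  assumes "0 \<le> t" "h \<in> Hspace nx L" "l \<in> Hspace nx L"
  shows "gram t (Hscale c h) l = c * gram t h l"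
proof -
  have "Heq L (S t (Hscale c h)) (Hscale c (S t h))"
    using C0_scale[OF C0] assms by simp
  then have "gram t (Hscale c h) l = Hinner L (Hscale c (S t h)) (S t l)"
    unfolding gram_def using assms
    by (intro Hinner_cong[where nx=nx]) (auto intro: closed Hscale_closed simp: Heq_def L2_eq_def)
  then show ?thesis using assms by (simp add: gram_def Hinner_scale_left[where nx=nx] closed)
qed

lemma gram_diff_left:
  assumes "0 \<le> t" "h \<in> Hspace nx L" "k \<in> Hspace nx L" "l \<in> Hspace nx L"
  shows "gram t (Hdiff h k) l = gram t h l - gram t k l"
  using assms by (simp add: Hdiff_eq_Hadd gram_add_left gram_scale_left Hscale_closed)

lemma gram_diff_right:
  assumes "0 \<le> t" "h \<in> Hspace nx L" "k \<in> Hspace nx L" "l \<in> Hspace nx L"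
  shows "gram t l (Hdiff h k) = gram t l h - gram t l k"
proof -
  note cl = Hdiff_closed[OF assms(2,3)]
  show ?thesis
    using gram_diff_left[OF assms] gram_commute[OF assms(1,4) cl]
      gram_commute[OF assms(1,4,2)] gram_commute[OF assms(1,4,3)] by simp
qed



lemma gram_le:
  assumes "0 \<le> t" "h \<in> Hspace nx L" "k \<in> Hspace nx L"
  shows "\<bar>gram t h k\<bar> \<le> M\<^sup>2 * Hnorm L h * Hnorm L k"
proof -
  have "\<bar>gram t h k\<bar> \<le> Hnorm L (S t h) * Hnorm L (S t k)"
    unfolding gram_def using assms by (intro Hinner_le[where nx=nx] closed)
  also have "\<dots> \<le> (M * Hnorm L h) * (M * Hnorm L k)"
    using assms bound order_trans[OF Hnorm_nonneg bound] by (intro mult_mono) auto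
  finally show ?thesis by (simp add: power2_eq_square mult_ac)
qed

lemma gram_shift:
  assumes "0 \<le> t" "0 \<le> s" "h \<in> Hspace nx L" "k \<in> Hspace nx L"
  shows "gram (t + s) h k = gram t (S s h) (S s k)"
proof -
  have "Heq L (S (t + s) l) (S t (S s l))" if "l \<in> Hspace nx L" for l
    using C0_compose[OF C0] assms(1,2) that by simp
  then show ?thesis
    unfolding gram_def using assms by (intro Hinner_cong[where nx=nx] closed) simp_all
qed

lemma gram_0:
  assumes "h \<in> Hspace nx L" "k \<in> Hspace nx L"
  shows "gram 0 h k = Hinner L h k"
proof -
  have "Heq L (S 0 l) l" if "l \<in> Hspace nx L" for l
    using C0_zero[OF C0] that by simp
  then show ?thesis
    unfolding gram_def using assms by (intro Hinner_cong[where nx=nx] closed) simp_all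
qed

lemma strong_continuity:
  "h \<in> Hspace nx L \<Longrightarrow> ((\<lambda>t. Hnorm L (Hdiff (S t h) h)) \<longlongrightarrow> 0) (at_right 0)"
  by (rule C0_continuous[OF C0])

lemma gram_continuous:
  assumes h: "h \<in> Hspace nx L" and k: "k \<in> Hspace nx L"
  shows "continuous_on {0..} (\<lambda>t. gram t h k)"
proof (rule continuous_on_uniform_right)
  let ?d = "\<lambda>h s. Hnorm L (Hdiff (S s h) h)"
  let ?r = "\<lambda>s. M\<^sup>2 * ?d h s * (M * Hnorm L k) + M\<^sup>2 * Hnorm L h * ?d k s"
  have "(?r \<longlongrightarrow> M\<^sup>2 * 0 * (M * Hnorm L k) + M\<^sup>2 * Hnorm L h * 0) (at_right 0)"
    by (intro tendsto_intros strong_continuity h k)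
  then show "(?r \<longlongrightarrow> 0) (at_right 0)" by simp
  fix t s :: real assume t: "0 \<le> t" and s: "0 < s"
  note cl = h k closed[of s h] closed[of s k] Hdiff_closed[OF closed[of s h] h]
    Hdiff_closed[OF closed[of s k] k]
  have "gram (t + s) h k - gram t h k
      = gram t (Hdiff (S s h) h) (S s k) + gram t h (Hdiff (S s k) k)"
    using cl t s by (simp add: gram_shift gram_diff_left gram_diff_right)
  moreover have "\<bar>gram t (Hdiff (S s h) h) (S s k)\<bar> \<le> M\<^sup>2 * ?d h s * Hnorm L (S s k)"
    using cl t s by (intro gram_le) auto
  moreover have "M\<^sup>2 * ?d h s * Hnorm L (S s k) \<le> M\<^sup>2 * ?d h s * (M * Hnorm L k)"
    using bound[of s k] k s by (intro mult_left_mono) auto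
  moreover have "\<bar>gram t h (Hdiff (S s k) k)\<bar> \<le> M\<^sup>2 * Hnorm L h * ?d k s"
    using cl t s by (intro gram_le) auto
  ultimately show "\<bar>gram (t + s) h k - gram t h k\<bar> \<le> ?r s" by linarith
qed

lemma gram_integrable:
  assumes "h \<in> Hspace nx L" "k \<in> Hspace nx L"
  shows "(\<lambda>t. gram t h k) integrable_on {0..T}"
  by (rule integrable_continuous_real, rule continuous_on_subset[OF gram_continuous[OF assms]]) auto



text \<open>
  If \<open>g\<close> is the image of \<open>h\<close> under the generator, then $\|S(t) h\|^2$ has the derivative
  $2 \langle S(t) h, S(t) g \rangle$.
\<close>

lemma gram_has_integral:
  assumes h: "h \<in> Hspace nx L" and g: "g \<in> Hspace nx L" and T: "0 \<le> T"
    and gen: "((\<lambda>t. Hnorm L (Hdiff (Hscale (1 / t) (Hdiff (S t h) h)) g)) \<longlongrightarrow> 0) (at_right 0)"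
  shows "((\<lambda>t. 2 * gram t h g) has_integral (gram T h h - gram 0 h h)) {0..T}"
proof (rule has_integral_uniform_right_derivative)
  let ?k = "\<lambda>s. Hdiff (S s h) h"
  let ?e = "\<lambda>s. Hdiff (Hscale (1 / s) (?k s)) g"
  let ?r = "\<lambda>s. 2 * (M\<^sup>2 * Hnorm L h * Hnorm L (?e s))
    + (M\<^sup>2 * Hnorm L (?k s) * Hnorm L (?e s) + M\<^sup>2 * Hnorm L (?k s) * Hnorm L g)"
  have "(?r \<longlongrightarrow> 2 * (M\<^sup>2 * Hnorm L h * 0) + (M\<^sup>2 * 0 * 0 + M\<^sup>2 * 0 * Hnorm L g)) (at_right 0)"
    by (intro tendsto_intros strong_continuity h gen)
  then show "(?r \<longlongrightarrow> 0) (at_right 0)" by simp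
  show "continuous_on {0..} (\<lambda>t. 2 * gram t h g)"
    by (intro continuous_intros gram_continuous h g)
  show "0 \<le> T" by fact
  fix t s :: real assume t: "0 \<le> t" and s: "0 < s"
  have Ss: "S s h \<in> Hspace nx L" using closed s h by simp
  define k e where "k = ?k s" and "e = ?e s"
  have k: "k \<in> Hspace nx L" unfolding k_def using Hdiff_closed Ss h by blast
  have sk: "Hscale (1 / s) k \<in> Hspace nx L" using Hscale_closed k by blast
  have e: "e \<in> Hspace nx L"
    unfolding e_def using Hdiff_closed sk g unfolding k_def by blast
  \<comment> \<open>\<open>k = S(s) h - h = s (g + e)\<close>, where \<open>e\<close> tends to \<open>0\<close> with \<open>s\<close>\<close>
  have expand: "gram t l k = s * (gram t l e + gram t l g)" if l: "l \<in> Hspace nx L" for l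
  proof -
    have "gram t e l = 1 / s * gram t k l - gram t g l"
      unfolding e_def using gram_diff_left[OF t sk g l] gram_scale_left[OF t k l]
      unfolding k_def by simp
    then have "gram t k l = s * (gram t e l + gram t g l)"
      using s by (simp add: field_simps)
    then show ?thesis
      using gram_commute[OF t l k] gram_commute[OF t l e] gram_commute[OF t l g] by simp
  qed
  have "gram t k k = gram t (S s h) (S s h) - gram t h (S s h) - gram t h k"
    "gram t h k = gram t h (S s h) - gram t h h"
    unfolding k_def
    using gram_diff_left[OF t Ss h k] gram_diff_right[OF t Ss h h] gram_diff_right[OF t Ss h Ss]
      gram_commute[OF t h Ss] unfolding k_def by simp_all
  then have "gram (t + s) h h - gram t h h = 2 * gram t h k + gram t k k"
    using gram_shift[of t s h h] t s h by simp
  also have "\<dots> = s * (2 * gram t h e + 2 * gram t h g + (gram t k e + gram t k g))"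
    unfolding expand[OF h] expand[OF k] by (simp add: algebra_simps)
  finally have "gram (t + s) h h - gram t h h - s * (2 * gram t h g)
      = s * (2 * gram t h e + (gram t k e + gram t k g))"
    by (simp add: algebra_simps)
  then have "\<bar>gram (t + s) h h - gram t h h - s * (2 * gram t h g)\<bar>
      = s * \<bar>2 * gram t h e + (gram t k e + gram t k g)\<bar>"
    using s by (simp add: abs_mult)
  also have "\<dots> \<le> s * ?r s"
  proof (rule mult_left_mono)
    show "\<bar>2 * gram t h e + (gram t k e + gram t k g)\<bar> \<le> ?r s"
      using gram_le[OF t h e] gram_le[OF t k e] gram_le[OF t k g]
      unfolding e_def k_def by linarith
  qed (use s in simp)
  finally show "\<bar>gram (t + s) h h - gram t h h - s * (2 * gram t h g)\<bar> \<le> s * ?r s" .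
qed

end


text \<open>By homogeneity, stability of the origin is a uniform bound on the operator norms.\<close>

lemma globally_asymptotically_stable_bound:
  assumes C0: "C0_semigroup nx L S" and gas: "globally_asymptotically_stable nx L S"
  obtains M where "bounded_semigroup nx L S M"
proof -
  have "\<exists>\<delta>>0. \<forall>h\<in>Hspace nx L. Hnorm L h \<le> \<delta> \<longrightarrow> (\<forall>t\<ge>0. Hnorm L (S t h) \<le> 1)"
    using gas unfolding globally_asymptotically_stable_def by (simp del: One_nat_def)
  then obtain d where d: "d > 0"
    and d_le: "\<forall>h\<in>Hspace nx L. Hnorm L h \<le> d \<longrightarrow> (\<forall>t\<ge>0. Hnorm L (S t h) \<le> 1)"
    by (elim exE conjE)
  have le: "Hnorm L (S t h) \<le> 1" if "h \<in> Hspace nx L" "Hnorm L h \<le> d" "t \<ge> 0" for h t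
    using d_le that by simp
  note closed = C0_closed[OF C0]
  have "Hnorm L (S t h) \<le> 1 / d * Hnorm L h" if t: "0 \<le> t" and h: "h \<in> Hspace nx L" for t h
  proof (cases "Hnorm L h = 0")
    case True
    \<comment> \<open>a state of norm \<open>0\<close> cannot be rescaled; boundedness of \<open>S t\<close> applies instead\<close>
    obtain K where "\<forall>h\<in>Hspace nx L. Hnorm L (S t h) \<le> K * Hnorm L h"
      using C0_bounded[OF C0 t] ..
    then have "Hnorm L (S t h) \<le> K * Hnorm L h" using h by (rule bspec)
    then show ?thesis using True by simp
  next
    case False
    then have pos: "Hnorm L h > 0" using Hnorm_nonneg[of L h] by linarith
    let ?c = "d / Hnorm L h"
    have cl: "S t h \<in> Hspace nx L" "S t (Hscale ?c h) \<in> Hspace nx L"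
      using t h by (intro closed Hscale_closed; simp)+
    have "?c * Hnorm L (S t h) = Hnorm L (Hscale ?c (S t h))"
      using cl pos d by (simp add: Hnorm_scale)
    also have "\<dots> = Hnorm L (S t (Hscale ?c h))"
    proof -
      have "Heq L (S t (Hscale ?c h)) (Hscale ?c (S t h))"
        by (rule C0_scale[OF C0 t h])
      then show ?thesis by (intro Hnorm_cong[where nx=nx, symmetric] cl Hscale_closed)
    qed
    also have "\<dots> \<le> 1"
      using pos d h by (intro le Hscale_closed t) (simp_all add: Hnorm_scale)
    finally show ?thesis using pos d by (simp add: field_simps)
  qed
  then show ?thesis using C0 that[of "1/d"] by (simp add: bounded_semigroup_def)
qed

section \<open>Quadratic and bilinear forms on coordinate vectors\<close>

lemma scalar_prod_self_eq: "scalar_prod v v = (\<Sum>i<dim_vec v. (vec_index v i)\<^sup>2)" for v :: "real Matrix.vec"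
  by (simp add: scalar_prod_def power2_eq_square atLeast0LessThan)

lemma scalar_prod_self_pos:
  fixes v :: "real Matrix.vec"
  assumes "v \<in> carrier_vec N" "v \<noteq> 0\<^sub>v N"
  shows "0 < scalar_prod v v"
proof -
  have "\<exists>i<N. vec_index v i \<noteq> 0"
  proof (rule ccontr)
    assume "\<not> ?thesis"
    then have "v = 0\<^sub>v N" using assms(1) by (intro eq_vecI) auto
    with assms(2) show False by simp
  qed
  then show ?thesis
    using assms(1) unfolding scalar_prod_self_eq by (auto intro!: sum_pos2)
qed

lemma scalar_prod_mult_mat_vec:
  fixes v w :: "real Matrix.vec"
  assumes "v \<in> carrier_vec N" "w \<in> carrier_vec N"
  shows "scalar_prod v (mat N N f *\<^sub>v w)
    = (\<Sum>i<N. \<Sum>j<N. vec_index v i * vec_index w j * f (i, j))"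
  using assms by (simp add: scalar_prod_def atLeast0LessThan sum_distrib_left mult_ac)

lemma linear_functional_vec:
  fixes l :: "real Matrix.vec \<Rightarrow> real"
  assumes add: "\<And>v w. v \<in> carrier_vec N \<Longrightarrow> w \<in> carrier_vec N \<Longrightarrow> l (v + w) = l v + l w"
    and scale: "\<And>c v. v \<in> carrier_vec N \<Longrightarrow> l (c \<cdot>\<^sub>v v) = c * l v"
    and v: "v \<in> carrier_vec N"
  shows "l v = (\<Sum>i<N. vec_index v i * l (unit_vec N i))"
proof -
  \<comment> \<open>\<open>p m\<close> keeps the first \<open>m\<close> entries of \<open>v\<close>\<close>
  define p where "p m = Matrix.vec N (\<lambda>i. if i < m then vec_index v i else 0)" for m :: nat
  have p: "p m \<in> carrier_vec N" for m by (simp add: p_def)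
  have "m \<le> N \<Longrightarrow> l (p m) = (\<Sum>i<m. vec_index v i * l (unit_vec N i))" for m
  proof (induction m)
    case 0
    have "p 0 = 0 \<cdot>\<^sub>v v" using v by (intro eq_vecI) (auto simp: p_def)
    then show ?case using scale[OF v, of 0] by simp
  next
    case (Suc m)
    have "p (Suc m) = p m + vec_index v m \<cdot>\<^sub>v unit_vec N m"
      using Suc.prems by (intro eq_vecI) (auto simp: p_def unit_vec_def less_Suc_eq)
    then show ?case using Suc by (simp add: add scale p)
  qed
  moreover have "p N = v" using v by (intro eq_vecI) (auto simp: p_def)
  ultimately show ?thesis by force
qed

lemma bilinear_form_mat:
  fixes b :: "real Matrix.vec \<Rightarrow> real Matrix.vec \<Rightarrow> real"
  assumes add: "\<And>u v w. u \<in> carrier_vec N \<Longrightarrow> v \<in> carrier_vec N \<Longrightarrow> w \<in> carrier_vec N \<Longrightarrow>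
      b (u + v) w = b u w + b v w"
    and scale: "\<And>c v w. v \<in> carrier_vec N \<Longrightarrow> w \<in> carrier_vec N \<Longrightarrow> b (c \<cdot>\<^sub>v v) w = c * b v w"
    and commute: "\<And>v w. v \<in> carrier_vec N \<Longrightarrow> w \<in> carrier_vec N \<Longrightarrow> b v w = b w v"
    and v: "v \<in> carrier_vec N" and w: "w \<in> carrier_vec N"
  shows "b v w = scalar_prod v (mat N N (\<lambda>(i, j). b (unit_vec N i) (unit_vec N j)) *\<^sub>v w)"
proof -
  have e: "unit_vec N i \<in> carrier_vec N" for i :: nat by simp
  have "b v w = (\<Sum>i<N. vec_index v i * b (unit_vec N i) w)"
    by (rule linear_functional_vec[of N "\<lambda>u. b u w"]) (simp_all add: add scale v w)
  also have "\<dots> = (\<Sum>i<N. vec_index v i * (\<Sum>j<N. vec_index w j * b (unit_vec N i) (unit_vec N j)))"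
  proof (rule sum.cong)
    fix i
    have "b w (unit_vec N i) = (\<Sum>j<N. vec_index w j * b (unit_vec N j) (unit_vec N i))"
      by (rule linear_functional_vec[of N "\<lambda>u. b u (unit_vec N i)"]) (simp_all add: add scale w)
    then show "vec_index v i * b (unit_vec N i) w
        = vec_index v i * (\<Sum>j<N. vec_index w j * b (unit_vec N i) (unit_vec N j))"
      using commute[OF w e] commute[OF e e] by simp
  qed simp
  finally show ?thesis
    using v w by (simp add: scalar_prod_mult_mat_vec sum_distrib_left mult.assoc)
qed

section \<open>The energy matrix of a finite-dimensional subspace\<close>

text \<open>
  A linear isometric embedding of $\mathbb{R}^N$ into the state space of a uniformly bounded semigroup.
  Additivity and homogeneity are equations between representatives, not only up to \<open>Heq\<close>.
\<close>

locale state_embedding = bounded_semigroup +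
  fixes N :: nat and E :: "real Matrix.vec \<Rightarrow> state"
  assumes embed: "\<And>v. v \<in> carrier_vec N \<Longrightarrow> E v \<in> Hspace nx L"
    and embed_add: "\<And>v w. v \<in> carrier_vec N \<Longrightarrow> w \<in> carrier_vec N \<Longrightarrow> E (v + w) = Hadd (E v) (E w)"
    and embed_scale: "\<And>c v. v \<in> carrier_vec N \<Longrightarrow> E (c \<cdot>\<^sub>v v) = Hscale c (E v)"
    and embed_inner: "\<And>v. v \<in> carrier_vec N \<Longrightarrow> Hinner L (E v) (E v) = scalar_prod v v"
begin

lemma gram_embed:
  assumes t: "0 \<le> t" and "v \<in> carrier_vec N" "w \<in> carrier_vec N"
  shows "gram t (E v) (E w) = (\<Sum>i<N. \<Sum>j<N. vec_index v i * vec_index w j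
    * gram t (E (unit_vec N i)) (E (unit_vec N j)))"
proof -
  have "gram t (E v) (E w) = scalar_prod v
      (mat N N (\<lambda>(i, j). gram t (E (unit_vec N i)) (E (unit_vec N j))) *\<^sub>v w)"
    using assms by (intro bilinear_form_mat)
      (simp_all add: embed_add embed_scale gram_add_left gram_scale_left embed gram_commute[OF t])
  then show ?thesis using assms by (simp add: scalar_prod_mult_mat_vec)
qed

text \<open>Strong convergence to the origin is uniform on the unit ball of a finite-dimensional space.\<close>

lemma eventually_contractive:
  assumes decay: "\<And>h. h \<in> Hspace nx L \<Longrightarrow> ((\<lambda>t. Hnorm L (S t h)) \<longlongrightarrow> 0) at_top"
  obtains T where "T > 0"
    and "\<And>v. v \<in> carrier_vec N \<Longrightarrow> v \<noteq> 0\<^sub>v N \<Longrightarrow> gram T (E v) (E v) < scalar_prod v v"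
proof -
  define G where "G t i j = gram t (E (unit_vec N i)) (E (unit_vec N j))" for t i j
  have "((\<lambda>t. G t i j) \<longlongrightarrow> 0) at_top" for i j
  proof (rule Lim_null_comparison)
    let ?n = "\<lambda>i t. Hnorm L (S t (E (unit_vec N i)))"
    have "(?n i \<longlongrightarrow> 0) at_top" for i by (intro decay embed) simp
    from tendsto_mult[OF this[of i] this[of j]]
    show "((\<lambda>t. ?n i t * ?n j t) \<longlongrightarrow> 0) at_top" by simp
    show "\<forall>\<^sub>F t in at_top. norm (G t i j) \<le> ?n i t * ?n j t"
      using eventually_ge_at_top[of 0]
    proof eventually_elim
      case (elim t)
      then show ?case unfolding G_def gram_def real_norm_def
        by (intro Hinner_le[where nx=nx] closed embed) simp_all
    qed
  qed
  then have "((\<lambda>t. \<Sum>i<N. \<Sum>j<N. \<bar>G t i j\<bar>) \<longlongrightarrow> (\<Sum>i<N. \<Sum>j<N. \<bar>0\<bar>)) at_top"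
    by (intro tendsto_intros)
  then have "\<forall>\<^sub>F t in at_top. (\<Sum>i<N. \<Sum>j<N. \<bar>G t i j\<bar>) < 1"
    by (rule order_tendstoD) simp
  then have "\<forall>\<^sub>F t in at_top. (\<Sum>i<N. \<Sum>j<N. \<bar>G t i j\<bar>) < 1 \<and> t > 0"
    using eventually_gt_at_top by (rule eventually_conj)
  then obtain T where T: "T > 0" "(\<Sum>i<N. \<Sum>j<N. \<bar>G T i j\<bar>) < 1"
    by (auto simp: eventually_at_top_linorder)
  have "gram T (E v) (E v) < scalar_prod v v" if v: "v \<in> carrier_vec N" "v \<noteq> 0\<^sub>v N" for v
  proof -
    have sq: "(vec_index v i)\<^sup>2 \<le> scalar_prod v v" if "i < N" for i
      using v that unfolding scalar_prod_self_eq by (intro member_le_sum) auto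
    have prod: "\<bar>vec_index v i * vec_index v j\<bar> \<le> scalar_prod v v" if "i < N" "j < N" for i j
      using sum_squares_bound[of "\<bar>vec_index v i\<bar>" "\<bar>vec_index v j\<bar>"] sq[OF that(1)] sq[OF that(2)]
      unfolding abs_mult power2_abs by linarith
    have "gram T (E v) (E v) = (\<Sum>i<N. \<Sum>j<N. vec_index v i * vec_index v j * G T i j)"
      using gram_embed[OF less_imp_le[OF T(1)] v(1) v(1)] unfolding G_def .
    also have "\<dots> \<le> (\<Sum>i<N. \<Sum>j<N. scalar_prod v v * \<bar>G T i j\<bar>)"
    proof (intro sum_mono)
      fix i j assume "i \<in> {..<N}" "j \<in> {..<N}"
      then have "\<bar>vec_index v i * vec_index v j\<bar> * \<bar>G T i j\<bar> \<le> scalar_prod v v * \<bar>G T i j\<bar>"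
        by (intro mult_right_mono prod) auto
      then show "vec_index v i * vec_index v j * G T i j \<le> scalar_prod v v * \<bar>G T i j\<bar>"
        using abs_ge_self[of "vec_index v i * vec_index v j * G T i j"]
        unfolding abs_mult[of _ "G T i j"] by linarith
    qed
    also have "\<dots> = scalar_prod v v * (\<Sum>i<N. \<Sum>j<N. \<bar>G T i j\<bar>)"
      by (simp add: sum_distrib_left)
    also have "\<dots> < scalar_prod v v"
      using T(2) scalar_prod_self_pos[OF v] by (simp add: mult_less_cancel_left1)
    finally show ?thesis .
  qed
  with T(1) show ?thesis by (rule that)
qed

text \<open>
  The Gram matrix of the energy accumulated up to time \<open>T\<close> along the trajectories that start from the
  embedded unit vectors.
\<close>

definition energy_mat :: "real \<Rightarrow> real Matrix.mat" where
  "energy_mat T = mat N N (\<lambda>(i, j).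
     integral {0..T} (\<lambda>t. gram t (E (unit_vec N i)) (E (unit_vec N j))))"

lemma energy_mat_form:
  assumes "v \<in> carrier_vec N" "w \<in> carrier_vec N"
  shows "scalar_prod v (energy_mat T *\<^sub>v w) = integral {0..T} (\<lambda>t. gram t (E v) (E w))"
  unfolding energy_mat_def
proof (rule bilinear_form_mat[symmetric])
  fix u v w :: "real Matrix.vec"
  assume u: "u \<in> carrier_vec N" and v: "v \<in> carrier_vec N" and w: "w \<in> carrier_vec N"
  have "integral {0..T} (\<lambda>t. gram t (E (u + v)) (E w))
      = integral {0..T} (\<lambda>t. gram t (E u) (E w) + gram t (E v) (E w))"
    using u v w by (intro integral_cong) (simp add: embed_add gram_add_left embed)
  then show "integral {0..T} (\<lambda>t. gram t (E (u + v)) (E w))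
      = integral {0..T} (\<lambda>t. gram t (E u) (E w)) + integral {0..T} (\<lambda>t. gram t (E v) (E w))"
    using u v w by (simp add: integral_add gram_integrable embed)
next
  fix c :: real and v w :: "real Matrix.vec"
  assume v: "v \<in> carrier_vec N" and w: "w \<in> carrier_vec N"
  have "integral {0..T} (\<lambda>t. gram t (E (c \<cdot>\<^sub>v v)) (E w)) = integral {0..T} (\<lambda>t. c * gram t (E v) (E w))"
    using v w by (intro integral_cong) (simp add: embed_scale gram_scale_left embed)
  then show "integral {0..T} (\<lambda>t. gram t (E (c \<cdot>\<^sub>v v)) (E w))
      = c * integral {0..T} (\<lambda>t. gram t (E v) (E w))"
    by simp
next
  fix v w :: "real Matrix.vec"
  assume v: "v \<in> carrier_vec N" and w: "w \<in> carrier_vec N"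
  show "integral {0..T} (\<lambda>t. gram t (E v) (E w)) = integral {0..T} (\<lambda>t. gram t (E w) (E v))"
    using v w by (intro integral_cong) (simp add: gram_commute embed)
qed fact+

lemma energy_mat_pos_def:
  assumes T: "T > 0"
  shows "pos_def_mat N (energy_mat T)"
  unfolding pos_def_mat_def
proof (intro conjI ballI impI)
  show "energy_mat T \<in> carrier_mat N N" by (simp add: energy_mat_def)
  show "transpose_mat (energy_mat T) = energy_mat T"
  proof (rule eq_matI)
    fix i j assume "i < dim_row (energy_mat T)" "j < dim_col (energy_mat T)"
    then have ij: "i < N" "j < N" by (simp_all add: energy_mat_def)
    have "integral {0..T} (\<lambda>t. gram t (E (unit_vec N i)) (E (unit_vec N j)))
        = integral {0..T} (\<lambda>t. gram t (E (unit_vec N j)) (E (unit_vec N i)))"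
      by (intro integral_cong) (simp add: gram_commute embed)
    then show "transpose_mat (energy_mat T) $$ (i, j) = energy_mat T $$ (i, j)"
      using ij by (simp add: energy_mat_def)
  qed (simp_all add: energy_mat_def)
  fix v :: "real Matrix.vec" assume v: "v \<in> carrier_vec N" "v \<noteq> 0\<^sub>v N"
  let ?f = "\<lambda>t. gram t (E v) (E v)"
  have cont: "continuous_on {0..T} ?f"
    by (rule continuous_on_subset[OF gram_continuous]) (auto simp: embed v)
  have nonneg: "0 \<le> ?f t" for t by (simp add: gram_self)
  have "?f 0 \<noteq> 0"
    using scalar_prod_self_pos[OF v] v by (simp add: gram_0 embed embed_inner)
  then have "integral {0..T} ?f \<noteq> 0"
    using integral_eq_0_iff[OF cont T nonneg] T by force
  moreover have "0 \<le> integral {0..T} ?f"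
    using nonneg by (intro integral_nonneg gram_integrable embed v) auto
  ultimately show "0 < scalar_prod v (energy_mat T *\<^sub>v v)"
    using v by (simp add: energy_mat_form)
qed

text \<open>
  The Lyapunov identity: along a trajectory that starts at \<open>E v\<close>, the energy over a window of length \<open>T\<close>
  gains $\|S(T) E v\|^2$ at the end of the window and loses $\|E v\|^2$ at its beginning.
\<close>

lemma energy_mat_derivative:
  assumes "generates nx L G S" and T: "0 \<le> T" and v: "v \<in> carrier_vec N" and w: "w \<in> carrier_vec N"
    and "(E v, E w) \<in> G"
  shows "2 * scalar_prod v (energy_mat T *\<^sub>v w) = gram T (E v) (E v) - scalar_prod v v"
proof -
  have "((\<lambda>t. Hnorm L (Hdiff (Hscale (1 / t) (Hdiff (S t (E v)) (E v))) (E w))) \<longlongrightarrow> 0) (at_right 0)"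
    using assms(1,5) embed[OF v] embed[OF w] unfolding generates_def by simp
  from gram_has_integral[OF embed[OF v] embed[OF w] T this]
  have "integral {0..T} (\<lambda>t. 2 * gram t (E v) (E w)) = gram T (E v) (E v) - gram 0 (E v) (E v)"
    by (rule integral_unique)
  then show ?thesis using v w by (simp add: energy_mat_form gram_0 embed embed_inner)
qed

end

section \<open>The matrices of the linear matrix inequality\<close>

lemma smult_mat_mult_vec:
  fixes c :: "'a :: comm_semiring_0"
  assumes "A \<in> carrier_mat nr nc" "v \<in> carrier_vec nc"
  shows "(c \<cdot>\<^sub>m A) *\<^sub>v v = c \<cdot>\<^sub>v (A *\<^sub>v v)"
  using assms by (intro eq_vecI) auto

lemma He_quadratic_form:
  assumes M: "M \<in> carrier_mat N N" and v: "v \<in> carrier_vec N"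
  shows "scalar_prod v (He M *\<^sub>v v) = 2 * scalar_prod v (M *\<^sub>v v)"
proof -
  have Mv: "M *\<^sub>v v \<in> carrier_vec N" "transpose_mat M *\<^sub>v v \<in> carrier_vec N"
    using M v by (simp_all add: mult_mat_vec_carrier[of _ N N])
  have "scalar_prod v (transpose_mat M *\<^sub>v v) = scalar_prod v (M *\<^sub>v v)"
    using comm_scalar_prod[OF v Mv(2)] transpose_vec_mult_scalar[OF M v v] by simp
  moreover have "He M *\<^sub>v v = M *\<^sub>v v + transpose_mat M *\<^sub>v v"
    unfolding He_def using M v by (intro add_mult_distrib_mat_vec) auto
  ultimately show ?thesis
    using scalar_prod_add_distrib[OF v Mv] by simp
qed

text \<open>
  $\Psi_n^-$ is the derivative of the quadratic form of $\Psi_n^+$ along the linear map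
  $(x, \zeta) \mapsto (Ax + B \Phi_o^\top \Delta^\top \zeta, \lambda\zeta + \nu(\Delta^\top)^2\zeta)$.
\<close>

lemma Psi_minus_quadratic_form:
  assumes A: "A \<in> carrier_mat nx nx" and B: "B \<in> carrier_mat nx 1"
    and D: "\<Delta> \<in> carrier_mat n n" and Phi: "\<Phi>o \<in> carrier_mat n 1"
    and P: "P \<in> carrier_mat nx nx" and Q: "Q \<in> carrier_mat nx n" and Tn: "Tn \<in> carrier_mat n n"
    and x: "x \<in> carrier_vec nx" and z: "\<zeta> \<in> carrier_vec n"
  defines "z1 \<equiv> transpose_mat \<Delta> *\<^sub>v \<zeta>"
  defines "z2 \<equiv> transpose_mat \<Delta> *\<^sub>v z1"
  defines "u \<equiv> B *\<^sub>v (transpose_mat \<Phi>o *\<^sub>v z1)"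
  shows "scalar_prod (x @\<^sub>v \<zeta>) (Psi_minus nx n A B lam \<nu> \<Delta> \<Phi>o P Q Tn *\<^sub>v (x @\<^sub>v \<zeta>))
    = 2 * scalar_prod (x @\<^sub>v \<zeta>)
        (Psi_plus P Q Tn *\<^sub>v ((A *\<^sub>v x + u) @\<^sub>v (lam \<cdot>\<^sub>v \<zeta> + \<nu> \<cdot>\<^sub>v z2)))"
proof -
  note mvc = mult_mat_vec_carrier
  have DT: "transpose_mat \<Delta> \<in> carrier_mat n n" using D by simp
  have z1: "z1 \<in> carrier_vec n" unfolding z1_def using DT z by (rule mvc)
  have z2: "z2 \<in> carrier_vec n" unfolding z2_def using DT z1 by (rule mvc)
  have PT: "transpose_mat \<Phi>o \<in> carrier_mat 1 n" using Phi by simp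
  have p: "transpose_mat \<Phi>o *\<^sub>v z1 \<in> carrier_vec 1" using PT z1 by (rule mvc)
  have u: "u \<in> carrier_vec nx" unfolding u_def using B p by (rule mvc)
  have Ax: "A *\<^sub>v x \<in> carrier_vec nx" using A x by (rule mvc)
  have Qz: "Q *\<^sub>v \<zeta> \<in> carrier_vec nx" using Q z by (rule mvc)
  have Qz2: "Q *\<^sub>v z2 \<in> carrier_vec nx" using Q z2 by (rule mvc)
  have Pu: "P *\<^sub>v u \<in> carrier_vec nx" using P u by (rule mvc)
  have PAx: "P *\<^sub>v (A *\<^sub>v x) \<in> carrier_vec nx" using P Ax by (rule mvc)
  have AT: "transpose_mat A \<in> carrier_mat nx nx" using A by simp
  have AQ: "transpose_mat A *\<^sub>v (Q *\<^sub>v \<zeta>) \<in> carrier_vec nx" using AT Qz by (rule mvc)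
  have QT: "transpose_mat Q \<in> carrier_mat n nx" using Q by simp
  have QTu: "transpose_mat Q *\<^sub>v u \<in> carrier_vec n" using QT u by (rule mvc)
  have QTA: "transpose_mat Q *\<^sub>v (A *\<^sub>v x) \<in> carrier_vec n" using QT Ax by (rule mvc)
  have Tz: "Tn *\<^sub>v \<zeta> \<in> carrier_vec n" using Tn z by (rule mvc)
  have Tz2: "Tn *\<^sub>v z2 \<in> carrier_vec n" using Tn z2 by (rule mvc)
  have BT: "transpose_mat B \<in> carrier_mat 1 nx" using B by simp
  have BQ: "transpose_mat B *\<^sub>v (Q *\<^sub>v \<zeta>) \<in> carrier_vec 1" using BT Qz by (rule mvc)
  have PBQ: "\<Phi>o *\<^sub>v (transpose_mat B *\<^sub>v (Q *\<^sub>v \<zeta>)) \<in> carrier_vec n" using Phi BQ by (rule mvc)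
  let ?s = "\<Delta> *\<^sub>v (\<Phi>o *\<^sub>v (transpose_mat B *\<^sub>v (Q *\<^sub>v \<zeta>)))"
  have s: "?s \<in> carrier_vec n" using D PBQ by (rule mvc)
  let ?xx = "Psi_xx A P" and ?xz = "Psi_xz nx A B lam \<nu> \<Delta> \<Phi>o P Q"
    and ?zz = "Psi_zz n B lam \<nu> \<Delta> \<Phi>o Q Tn"
  have xxm: "?xx \<in> carrier_mat nx nx" unfolding Psi_xx_def using P A by simp
  have sq: "transpose_mat \<Delta> ^\<^sub>m 2 = transpose_mat \<Delta> * transpose_mat \<Delta>"
    using DT by (simp add: numeral_2_eq_2)
  have sqm: "transpose_mat \<Delta> ^\<^sub>m 2 \<in> carrier_mat n n" unfolding sq using DT by simp
  have m1: "P * B * transpose_mat \<Phi>o * transpose_mat \<Delta> \<in> carrier_mat nx n"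
    using P B PT DT by (meson mult_carrier_mat)
  have m2: "lam \<cdot>\<^sub>m 1\<^sub>m nx + transpose_mat A \<in> carrier_mat nx nx" using AT by simp
  have m3: "(lam \<cdot>\<^sub>m 1\<^sub>m nx + transpose_mat A) * Q \<in> carrier_mat nx n" using m2 Q by simp
  have m4: "Q * (transpose_mat \<Delta> ^\<^sub>m 2) \<in> carrier_mat nx n" using Q sqm by simp
  have xzm: "?xz \<in> carrier_mat nx n" unfolding Psi_xz_def using m1 m3 m4 by simp
  have m5: "\<Delta> * \<Phi>o * transpose_mat B * Q \<in> carrier_mat n n"
    using D Phi BT Q by (meson mult_carrier_mat)
  have m6: "lam \<cdot>\<^sub>m 1\<^sub>m n + \<nu> \<cdot>\<^sub>m (transpose_mat \<Delta> ^\<^sub>m 2) \<in> carrier_mat n n" using sqm by simp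
  have m7: "Tn * (lam \<cdot>\<^sub>m 1\<^sub>m n + \<nu> \<cdot>\<^sub>m (transpose_mat \<Delta> ^\<^sub>m 2)) \<in> carrier_mat n n"
    using Tn m6 by simp
  have zzm: "?zz \<in> carrier_mat n n" unfolding Psi_zz_def using m5 m7 by simp
  have sqz: "transpose_mat \<Delta> ^\<^sub>m 2 *\<^sub>v \<zeta> = z2"
    unfolding sq z2_def z1_def using DT DT z by (rule assoc_mult_mat_vec)
  have one: "(lam \<cdot>\<^sub>m 1\<^sub>m m) *\<^sub>v v = lam \<cdot>\<^sub>v v" if "v \<in> carrier_vec m" for m v
    using that by (simp add: smult_mat_mult_vec[of _ m m])
  have xx: "?xx *\<^sub>v x = P *\<^sub>v (A *\<^sub>v x)"
    unfolding Psi_xx_def using P A x by (rule assoc_mult_mat_vec)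
  have xz: "?xz *\<^sub>v \<zeta> = P *\<^sub>v u + (lam \<cdot>\<^sub>v (Q *\<^sub>v \<zeta>) + transpose_mat A *\<^sub>v (Q *\<^sub>v \<zeta>)) + \<nu> \<cdot>\<^sub>v (Q *\<^sub>v z2)"
  proof -
    have PB: "P * B \<in> carrier_mat nx 1" using P B by simp
    have PBP: "P * B * transpose_mat \<Phi>o \<in> carrier_mat nx n" using PB PT by simp
    have m13: "P * B * transpose_mat \<Phi>o * transpose_mat \<Delta>
        + (lam \<cdot>\<^sub>m 1\<^sub>m nx + transpose_mat A) * Q \<in> carrier_mat nx n" using m3 by simp
    have m4': "\<nu> \<cdot>\<^sub>m (Q * (transpose_mat \<Delta> ^\<^sub>m 2)) \<in> carrier_mat nx n" using m4 by simp
    have "?xz *\<^sub>v \<zeta> = (P * B * transpose_mat \<Phi>o * transpose_mat \<Delta>) *\<^sub>v \<zeta>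
        + ((lam \<cdot>\<^sub>m 1\<^sub>m nx + transpose_mat A) * Q) *\<^sub>v \<zeta>
        + (\<nu> \<cdot>\<^sub>m (Q * (transpose_mat \<Delta> ^\<^sub>m 2))) *\<^sub>v \<zeta>"
      unfolding Psi_xz_def add_mult_distrib_mat_vec[OF m13 m4' z]
        add_mult_distrib_mat_vec[OF m1 m3 z] ..
    moreover have "(P * B * transpose_mat \<Phi>o * transpose_mat \<Delta>) *\<^sub>v \<zeta> = P *\<^sub>v u"
      using assoc_mult_mat_vec[OF PBP DT z] assoc_mult_mat_vec[OF PB PT z1]
        assoc_mult_mat_vec[OF P B p] by (simp add: z1_def u_def)
    moreover have "((lam \<cdot>\<^sub>m 1\<^sub>m nx + transpose_mat A) * Q) *\<^sub>v \<zeta>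
        = lam \<cdot>\<^sub>v (Q *\<^sub>v \<zeta>) + transpose_mat A *\<^sub>v (Q *\<^sub>v \<zeta>)"
      using assoc_mult_mat_vec[OF m2 Q z] add_mult_distrib_mat_vec[OF _ AT Qz, of "lam \<cdot>\<^sub>m 1\<^sub>m nx"]
        one[OF Qz] by simp
    moreover have "(\<nu> \<cdot>\<^sub>m (Q * (transpose_mat \<Delta> ^\<^sub>m 2))) *\<^sub>v \<zeta> = \<nu> \<cdot>\<^sub>v (Q *\<^sub>v z2)"
      using smult_mat_mult_vec[OF m4 z] assoc_mult_mat_vec[OF Q sqm z] sqz by simp
    ultimately show ?thesis by simp
  qed
  have zz: "?zz *\<^sub>v \<zeta> = ?s + (lam \<cdot>\<^sub>v (Tn *\<^sub>v \<zeta>) + \<nu> \<cdot>\<^sub>v (Tn *\<^sub>v z2))"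
  proof -
    have DP: "\<Delta> * \<Phi>o \<in> carrier_mat n 1" using D Phi by simp
    have DPB: "\<Delta> * \<Phi>o * transpose_mat B \<in> carrier_mat n nx" using DP BT by simp
    have "?zz *\<^sub>v \<zeta> = (\<Delta> * \<Phi>o * transpose_mat B * Q) *\<^sub>v \<zeta>
        + (Tn * (lam \<cdot>\<^sub>m 1\<^sub>m n + \<nu> \<cdot>\<^sub>m (transpose_mat \<Delta> ^\<^sub>m 2))) *\<^sub>v \<zeta>"
      unfolding Psi_zz_def using m5 m7 z by (rule add_mult_distrib_mat_vec)
    moreover have "(\<Delta> * \<Phi>o * transpose_mat B * Q) *\<^sub>v \<zeta> = ?s"
      using assoc_mult_mat_vec[OF DPB Q z] assoc_mult_mat_vec[OF DP BT Qz]
        assoc_mult_mat_vec[OF D Phi BQ] by simp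
    moreover have "(lam \<cdot>\<^sub>m 1\<^sub>m n + \<nu> \<cdot>\<^sub>m (transpose_mat \<Delta> ^\<^sub>m 2)) *\<^sub>v \<zeta> = lam \<cdot>\<^sub>v \<zeta> + \<nu> \<cdot>\<^sub>v z2"
      using add_mult_distrib_mat_vec[OF _ _ z, of "lam \<cdot>\<^sub>m 1\<^sub>m n" n "\<nu> \<cdot>\<^sub>m (transpose_mat \<Delta> ^\<^sub>m 2)"]
        sqm one[OF z] smult_mat_mult_vec[OF sqm z] sqz by simp
    then have "(Tn * (lam \<cdot>\<^sub>m 1\<^sub>m n + \<nu> \<cdot>\<^sub>m (transpose_mat \<Delta> ^\<^sub>m 2))) *\<^sub>v \<zeta>
        = lam \<cdot>\<^sub>v (Tn *\<^sub>v \<zeta>) + \<nu> \<cdot>\<^sub>v (Tn *\<^sub>v z2)"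
      using assoc_mult_mat_vec[OF Tn m6 z] mult_add_distrib_mat_vec[OF Tn, of "lam \<cdot>\<^sub>v \<zeta>" "\<nu> \<cdot>\<^sub>v z2"]
        mult_mat_vec[OF Tn z] mult_mat_vec[OF Tn z2] z z2 by simp
    ultimately show ?thesis by simp
  qed
  let ?M = "four_block_mat ?xx ?xz (0\<^sub>m n nx) ?zz"
  have M: "?M \<in> carrier_mat (nx + n) (nx + n)" using xxm zzm by (rule four_block_carrier_mat)
  have v: "x @\<^sub>v \<zeta> \<in> carrier_vec (nx + n)" using x z by simp
  have xzv: "?xz *\<^sub>v \<zeta> \<in> carrier_vec nx" using xzm z by (rule mvc)
  have zzv: "?zz *\<^sub>v \<zeta> \<in> carrier_vec n" using zzm z by (rule mvc)
  have "?M *\<^sub>v (x @\<^sub>v \<zeta>) = (?xx *\<^sub>v x + ?xz *\<^sub>v \<zeta>) @\<^sub>v (0\<^sub>m n nx *\<^sub>v x + ?zz *\<^sub>v \<zeta>)"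
    using xxm xzm _ zzm x z by (rule four_block_mat_mult_vec) simp
  also have "0\<^sub>m n nx *\<^sub>v x + ?zz *\<^sub>v \<zeta> = ?zz *\<^sub>v \<zeta>"
  proof -
    have "0\<^sub>m n nx *\<^sub>v x = 0\<^sub>v n" using x by (intro eq_vecI) auto
    then show ?thesis using left_zero_vec[OF zzv] by simp
  qed
  finally have "scalar_prod (x @\<^sub>v \<zeta>) (?M *\<^sub>v (x @\<^sub>v \<zeta>))
      = scalar_prod x (?xx *\<^sub>v x + ?xz *\<^sub>v \<zeta>) + scalar_prod \<zeta> (?zz *\<^sub>v \<zeta>)"
    using scalar_prod_append[OF x z, of "?xx *\<^sub>v x + ?xz *\<^sub>v \<zeta>" "?zz *\<^sub>v \<zeta>"] xzv zzv PAx
    unfolding xx by simp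
  moreover have "scalar_prod x (?xx *\<^sub>v x + ?xz *\<^sub>v \<zeta>) = scalar_prod x (P *\<^sub>v (A *\<^sub>v x)) + scalar_prod x (P *\<^sub>v u)
      + lam * scalar_prod x (Q *\<^sub>v \<zeta>) + scalar_prod x (transpose_mat A *\<^sub>v (Q *\<^sub>v \<zeta>))
      + \<nu> * scalar_prod x (Q *\<^sub>v z2)"
    unfolding xx xz using x PAx Pu Qz AQ Qz2
    by (simp add: scalar_prod_add_distrib[of _ nx] scalar_prod_smult_distrib[of _ nx])
  moreover have "scalar_prod \<zeta> (?zz *\<^sub>v \<zeta>) = scalar_prod \<zeta> ?s + lam * scalar_prod \<zeta> (Tn *\<^sub>v \<zeta>)
      + \<nu> * scalar_prod \<zeta> (Tn *\<^sub>v z2)"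
    unfolding zz using z s Tz Tz2
    by (simp add: scalar_prod_add_distrib[of _ n] scalar_prod_smult_distrib[of _ n])
  \<comment> \<open>the terms with $A^\top$ and $B^\top$ are, transposed, those with $Q^\top$ in the form of $\Psi_n^+$\<close>
  moreover have "scalar_prod x (transpose_mat A *\<^sub>v (Q *\<^sub>v \<zeta>))
      = scalar_prod \<zeta> (transpose_mat Q *\<^sub>v (A *\<^sub>v x))"
    using transpose_vec_mult_scalar[OF A x Qz] transpose_vec_mult_scalar[OF Q z Ax]
      comm_scalar_prod[OF x AQ] comm_scalar_prod[OF z QTA] comm_scalar_prod[OF Ax Qz] by simp
  moreover have "scalar_prod \<zeta> ?s = scalar_prod \<zeta> (transpose_mat Q *\<^sub>v u)"
  proof -
    have "scalar_prod \<zeta> ?s = scalar_prod z1 (\<Phi>o *\<^sub>v (transpose_mat B *\<^sub>v (Q *\<^sub>v \<zeta>)))"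
      unfolding z1_def using transpose_vec_mult_scalar[OF D PBQ z] by simp
    also have "\<dots> = scalar_prod (transpose_mat \<Phi>o *\<^sub>v z1) (transpose_mat B *\<^sub>v (Q *\<^sub>v \<zeta>))"
      using transpose_vec_mult_scalar[OF Phi BQ z1] by simp
    also have "\<dots> = scalar_prod (transpose_mat B *\<^sub>v (Q *\<^sub>v \<zeta>)) (transpose_mat \<Phi>o *\<^sub>v z1)"
      by (rule comm_scalar_prod[OF p BQ])
    also have "\<dots> = scalar_prod (Q *\<^sub>v \<zeta>) u"
      unfolding u_def using transpose_vec_mult_scalar[OF B p Qz] by simp
    also have "\<dots> = scalar_prod u (Q *\<^sub>v \<zeta>)" by (rule comm_scalar_prod[OF Qz u])
    also have "\<dots> = scalar_prod (transpose_mat Q *\<^sub>v u) \<zeta>"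
      using transpose_vec_mult_scalar[OF Q z u] by simp
    also have "\<dots> = scalar_prod \<zeta> (transpose_mat Q *\<^sub>v u)" by (rule comm_scalar_prod[OF QTu z])
    finally show ?thesis .
  qed
  moreover have "scalar_prod (x @\<^sub>v \<zeta>)
      (Psi_plus P Q Tn *\<^sub>v ((A *\<^sub>v x + u) @\<^sub>v (lam \<cdot>\<^sub>v \<zeta> + \<nu> \<cdot>\<^sub>v z2)))
      = scalar_prod x (P *\<^sub>v (A *\<^sub>v x)) + scalar_prod x (P *\<^sub>v u)
        + (lam * scalar_prod x (Q *\<^sub>v \<zeta>) + \<nu> * scalar_prod x (Q *\<^sub>v z2))
      + (scalar_prod \<zeta> (transpose_mat Q *\<^sub>v (A *\<^sub>v x)) + scalar_prod \<zeta> (transpose_mat Q *\<^sub>v u)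
        + (lam * scalar_prod \<zeta> (Tn *\<^sub>v \<zeta>) + \<nu> * scalar_prod \<zeta> (Tn *\<^sub>v z2)))"
  proof -
    let ?y = "A *\<^sub>v x + u" and ?e = "lam \<cdot>\<^sub>v \<zeta> + \<nu> \<cdot>\<^sub>v z2"
    have y: "?y \<in> carrier_vec nx" using u Ax by simp
    have e: "?e \<in> carrier_vec n" using z z2 by simp
    have Py: "P *\<^sub>v ?y = P *\<^sub>v (A *\<^sub>v x) + P *\<^sub>v u" using P Ax u by (rule mult_add_distrib_mat_vec)
    have Qy: "transpose_mat Q *\<^sub>v ?y = transpose_mat Q *\<^sub>v (A *\<^sub>v x) + transpose_mat Q *\<^sub>v u"
      using QT Ax u by (rule mult_add_distrib_mat_vec)
    have Qe: "Q *\<^sub>v ?e = lam \<cdot>\<^sub>v (Q *\<^sub>v \<zeta>) + \<nu> \<cdot>\<^sub>v (Q *\<^sub>v z2)"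
      using mult_add_distrib_mat_vec[OF Q, of "lam \<cdot>\<^sub>v \<zeta>" "\<nu> \<cdot>\<^sub>v z2"] z z2
        mult_mat_vec[OF Q z] mult_mat_vec[OF Q z2] by simp
    have Te: "Tn *\<^sub>v ?e = lam \<cdot>\<^sub>v (Tn *\<^sub>v \<zeta>) + \<nu> \<cdot>\<^sub>v (Tn *\<^sub>v z2)"
      using mult_add_distrib_mat_vec[OF Tn, of "lam \<cdot>\<^sub>v \<zeta>" "\<nu> \<cdot>\<^sub>v z2"] z z2
        mult_mat_vec[OF Tn z] mult_mat_vec[OF Tn z2] by simp
    have "Psi_plus P Q Tn *\<^sub>v (?y @\<^sub>v ?e)
        = (P *\<^sub>v ?y + Q *\<^sub>v ?e) @\<^sub>v (transpose_mat Q *\<^sub>v ?y + Tn *\<^sub>v ?e)"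
      unfolding Psi_plus_def using P Q QT Tn y e by (rule four_block_mat_mult_vec)
    moreover have "P *\<^sub>v ?y + Q *\<^sub>v ?e \<in> carrier_vec nx" unfolding Py Qe using PAx Pu Qz Qz2 by simp
    moreover have "transpose_mat Q *\<^sub>v ?y + Tn *\<^sub>v ?e \<in> carrier_vec n"
      unfolding Qy Te using QTA QTu Tz Tz2 by simp
    ultimately have "scalar_prod (x @\<^sub>v \<zeta>) (Psi_plus P Q Tn *\<^sub>v (?y @\<^sub>v ?e))
        = scalar_prod x (P *\<^sub>v ?y + Q *\<^sub>v ?e) + scalar_prod \<zeta> (transpose_mat Q *\<^sub>v ?y + Tn *\<^sub>v ?e)"
      using scalar_prod_append[OF x z] by simp
    also have "\<dots> = scalar_prod x (P *\<^sub>v (A *\<^sub>v x)) + scalar_prod x (P *\<^sub>v u)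
        + (lam * scalar_prod x (Q *\<^sub>v \<zeta>) + \<nu> * scalar_prod x (Q *\<^sub>v z2))
      + (scalar_prod \<zeta> (transpose_mat Q *\<^sub>v (A *\<^sub>v x)) + scalar_prod \<zeta> (transpose_mat Q *\<^sub>v u)
        + (lam * scalar_prod \<zeta> (Tn *\<^sub>v \<zeta>) + \<nu> * scalar_prod \<zeta> (Tn *\<^sub>v z2)))"
      unfolding Py Qe Qy Te using x z PAx Pu Qz Qz2 QTA QTu Tz Tz2
      by (simp add: scalar_prod_add_distrib[of _ nx] scalar_prod_smult_distrib[of _ nx]
          scalar_prod_add_distrib[of _ n] scalar_prod_smult_distrib[of _ n])
    finally show ?thesis .
  qed
  moreover have "scalar_prod (x @\<^sub>v \<zeta>) (Psi_minus nx n A B lam \<nu> \<Delta> \<Phi>o P Q Tn *\<^sub>v (x @\<^sub>v \<zeta>))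
      = 2 * scalar_prod (x @\<^sub>v \<zeta>) (?M *\<^sub>v (x @\<^sub>v \<zeta>))"
    unfolding Psi_minus_def using M v by (rule He_quadratic_form)
  ultimately show ?thesis by (simp add: algebra_simps)
qed

lemma Psi_minus_carrier_symmetric:
  assumes "A \<in> carrier_mat nx nx" "\<Delta> \<in> carrier_mat n n"
    "P \<in> carrier_mat nx nx" "Tn \<in> carrier_mat n n"
  shows "Psi_minus nx n A B lam \<nu> \<Delta> \<Phi>o P Q Tn \<in> carrier_mat (nx + n) (nx + n)"
    and "transpose_mat (Psi_minus nx n A B lam \<nu> \<Delta> \<Phi>o P Q Tn) = Psi_minus nx n A B lam \<nu> \<Delta> \<Phi>o P Q Tn"
proof -
  let ?M = "four_block_mat (Psi_xx A P) (Psi_xz nx A B lam \<nu> \<Delta> \<Phi>o P Q)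
                        (0\<^sub>m n nx) (Psi_zz n B lam \<nu> \<Delta> \<Phi>o Q Tn)"
  have xx: "Psi_xx A P \<in> carrier_mat nx nx" unfolding Psi_xx_def using assms by simp
  have "transpose_mat \<Delta> ^\<^sub>m 2 \<in> carrier_mat n n"
    using assms by (simp add: numeral_2_eq_2)
  then have "Tn * (lam \<cdot>\<^sub>m 1\<^sub>m n + \<nu> \<cdot>\<^sub>m (transpose_mat \<Delta> ^\<^sub>m 2)) \<in> carrier_mat n n"
    using assms by simp
  then have zz: "Psi_zz n B lam \<nu> \<Delta> \<Phi>o Q Tn \<in> carrier_mat n n" unfolding Psi_zz_def by simp
  have M: "?M \<in> carrier_mat (nx + n) (nx + n)" using xx zz by (rule four_block_carrier_mat)
  then have MT: "transpose_mat ?M \<in> carrier_mat (nx + n) (nx + n)" by simp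
  show "Psi_minus nx n A B lam \<nu> \<Delta> \<Phi>o P Q Tn \<in> carrier_mat (nx + n) (nx + n)"
    unfolding Psi_minus_def He_def using M MT by simp
  show "transpose_mat (Psi_minus nx n A B lam \<nu> \<Delta> \<Phi>o P Q Tn) = Psi_minus nx n A B lam \<nu> \<Delta> \<Phi>o P Q Tn"
    unfolding Psi_minus_def He_def transpose_add[OF M MT] transpose_transpose
    by (rule comm_add_mat[OF MT M])
qed

text \<open>A symmetric matrix is split into blocks; diagonal blocks inherit positive definiteness.\<close>

lemma pos_def_mat_blocks:
  assumes V: "pos_def_mat (nx + n) V"
  obtains P Q Tn where "pos_def_mat nx P" "Q \<in> carrier_mat nx n" "pos_def_mat n Tn"
    "V = Psi_plus P Q Tn"
proof -
  define P Q Tn where "P = mat nx nx (\<lambda>(i, j). V $$ (i, j))"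
    and "Q = mat nx n (\<lambda>(i, j). V $$ (i, nx + j))"
    and "Tn = mat n n (\<lambda>(i, j). V $$ (nx + i, nx + j))"
  have Vc: "V \<in> carrier_mat (nx + n) (nx + n)" and VT: "transpose_mat V = V"
    and pos: "\<And>v. v \<in> carrier_vec (nx + n) \<Longrightarrow> v \<noteq> 0\<^sub>v (nx + n) \<Longrightarrow> 0 < scalar_prod v (V *\<^sub>v v)"
    using V unfolding pos_def_mat_def by blast+
  have sym: "V $$ (i, j) = V $$ (j, i)" if "i < nx + n" "j < nx + n" for i j
    using index_transpose_mat(1)[of j V i] Vc VT that by simp
  have c: "P \<in> carrier_mat nx nx" "Q \<in> carrier_mat nx n" "Tn \<in> carrier_mat n n"
    by (simp_all add: P_def Q_def Tn_def)
  have eq: "V = Psi_plus P Q Tn"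
    unfolding Psi_plus_def
  proof (rule eq_matI)
    fix i j assume "i < dim_row (four_block_mat P Q (transpose_mat Q) Tn)"
      "j < dim_col (four_block_mat P Q (transpose_mat Q) Tn)"
    then have ij: "i < nx + n" "j < nx + n" using c by simp_all
    then show "V $$ (i, j) = four_block_mat P Q (transpose_mat Q) Tn $$ (i, j)"
      using c sym[OF ij] by (auto simp: P_def Q_def Tn_def)
  qed (use c Vc in auto)
  have QT: "transpose_mat Q \<in> carrier_mat n nx" using c by simp
  have form: "scalar_prod (x @\<^sub>v z) (V *\<^sub>v (x @\<^sub>v z))
      = scalar_prod x (P *\<^sub>v x + Q *\<^sub>v z) + scalar_prod z (transpose_mat Q *\<^sub>v x + Tn *\<^sub>v z)"
    if x: "x \<in> carrier_vec nx" and z: "z \<in> carrier_vec n" for x z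
  proof -
    have "V *\<^sub>v (x @\<^sub>v z) = (P *\<^sub>v x + Q *\<^sub>v z) @\<^sub>v (transpose_mat Q *\<^sub>v x + Tn *\<^sub>v z)"
      unfolding eq Psi_plus_def using c(1,2) QT c(3) x z by (rule four_block_mat_mult_vec)
    moreover have "P *\<^sub>v x + Q *\<^sub>v z \<in> carrier_vec nx"
      "transpose_mat Q *\<^sub>v x + Tn *\<^sub>v z \<in> carrier_vec n"
      using c QT x z by (auto intro!: add_carrier_vec mult_mat_vec_carrier)
    ultimately show ?thesis using scalar_prod_append[OF x z] by simp
  qed
  have zero: "0\<^sub>v nx @\<^sub>v 0\<^sub>v n = (0\<^sub>v (nx + n) :: real Matrix.vec)"
    by (intro eq_vecI) auto
  have "pos_def_mat nx P"
    unfolding pos_def_mat_def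
  proof (intro conjI ballI impI)
    show "transpose_mat P = P"
      by (rule eq_matI) (auto simp: P_def sym)
    fix x :: "real Matrix.vec" assume x: "x \<in> carrier_vec nx" "x \<noteq> 0\<^sub>v nx"
    have Px: "P *\<^sub>v x \<in> carrier_vec nx" using c(1) x(1) by (rule mult_mat_vec_carrier)
    have "x @\<^sub>v 0\<^sub>v n \<noteq> 0\<^sub>v (nx + n)"
      unfolding zero[symmetric] using x append_vec_eq[OF x(1), of "0\<^sub>v nx"] by simp
    with x have "0 < scalar_prod (x @\<^sub>v 0\<^sub>v n) (V *\<^sub>v (x @\<^sub>v 0\<^sub>v n))" by (intro pos) auto
    moreover have "Q *\<^sub>v 0\<^sub>v n = 0\<^sub>v nx" using c(2) by (intro eq_vecI) auto
    moreover have "transpose_mat Q *\<^sub>v x + Tn *\<^sub>v 0\<^sub>v n \<in> carrier_vec n"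
      using c QT x by (auto intro!: add_carrier_vec mult_mat_vec_carrier)
    ultimately show "0 < scalar_prod x (P *\<^sub>v x)"
      using form[OF x(1), of "0\<^sub>v n"] Px by simp
  qed (fact c)
  moreover have "pos_def_mat n Tn"
    unfolding pos_def_mat_def
  proof (intro conjI ballI impI)
    show "transpose_mat Tn = Tn"
      by (rule eq_matI) (auto simp: Tn_def sym)
    fix z :: "real Matrix.vec" assume z: "z \<in> carrier_vec n" "z \<noteq> 0\<^sub>v n"
    have Tz: "Tn *\<^sub>v z \<in> carrier_vec n" using c(3) z(1) by (rule mult_mat_vec_carrier)
    have "0\<^sub>v nx @\<^sub>v z \<noteq> 0\<^sub>v (nx + n)"
      unfolding zero[symmetric] using z append_vec_eq[of "0\<^sub>v nx :: real Matrix.vec" nx "0\<^sub>v nx"] by simp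
    with z have "0 < scalar_prod (0\<^sub>v nx @\<^sub>v z) (V *\<^sub>v (0\<^sub>v nx @\<^sub>v z))" by (intro pos) auto
    moreover have "transpose_mat Q *\<^sub>v 0\<^sub>v nx = 0\<^sub>v n" using c(2) by (intro eq_vecI) auto
    moreover have "P *\<^sub>v 0\<^sub>v nx + Q *\<^sub>v z \<in> carrier_vec nx"
      using c QT z by (auto intro!: add_carrier_vec mult_mat_vec_carrier)
    ultimately show "0 < scalar_prod z (Tn *\<^sub>v z)"
      using form[OF _ z(1), of "0\<^sub>v nx"] Tz by simp
  qed (fact c)
  ultimately show ?thesis using c(2) eq that by blast
qed

lemma kernel_basis_mat_mult:
  assumes basis: "kernel_basis_mat m K R" and K: "K \<in> carrier_mat r m"
    and w: "w \<in> carrier_vec (dim_col R)" "w \<noteq> 0\<^sub>v (dim_col R)"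
  shows "R *\<^sub>v w \<in> carrier_vec m" "R *\<^sub>v w \<noteq> 0\<^sub>v m" "K *\<^sub>v (R *\<^sub>v w) = 0\<^sub>v r"
proof -
  interpret kernel r m K by unfold_locales (rule K)
  have R: "R \<in> carrier_mat m (dim_col R)" and dist: "distinct (cols R)" and b: "basis (set (cols R))"
    using basis unfolding kernel_basis_mat_def by blast+
  have sub: "set (cols R) \<subseteq> mat_kernel K" and indep: "\<not> lin_dep (set (cols R))"
    using b unfolding Ker.basis_def by auto
  show "R *\<^sub>v w \<in> carrier_vec m" using R w(1) by (rule mult_mat_vec_carrier)
  show "R *\<^sub>v w \<noteq> 0\<^sub>v m"
    using NC.lin_depI[OF R w _ dist] indep lindep_same[OF sub] by blast
  have "K * R = 0\<^sub>m r (dim_col R)"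
  proof (rule eq_matI)
    fix i j assume "i < dim_row (0\<^sub>m r (dim_col R) :: real Matrix.mat)"
      "j < dim_col (0\<^sub>m r (dim_col R) :: real Matrix.mat)"
    then have ij: "i < r" "j < dim_col R" by simp_all
    then have "Matrix.col R j \<in> mat_kernel K" using sub by (auto simp: cols_def)
    then have "K *\<^sub>v Matrix.col R j = 0\<^sub>v r" using mat_kernelD[OF K] by blast
    then have "vec_index (K *\<^sub>v Matrix.col R j) i = 0" using ij by simp
    then show "(K * R) $$ (i, j) = 0\<^sub>m r (dim_col R) $$ (i, j)" using ij K by simp
  qed (use K in auto)
  moreover have "0\<^sub>m r (dim_col R) *\<^sub>v w = 0\<^sub>v r" using w(1) by (intro eq_vecI) auto
  ultimately show "K *\<^sub>v (R *\<^sub>v w) = 0\<^sub>v r"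
    using assoc_mult_mat_vec[OF K R w(1)] by simp
qed

lemma neg_def_mat_congruence:
  assumes X: "X \<in> carrier_mat m m" and XT: "transpose_mat X = X" and R: "R \<in> carrier_mat m k"
    and neg: "\<And>w. w \<in> carrier_vec k \<Longrightarrow> w \<noteq> 0\<^sub>v k \<Longrightarrow> scalar_prod (R *\<^sub>v w) (X *\<^sub>v (R *\<^sub>v w)) < 0"
  shows "neg_def_mat k (transpose_mat R * X * R)"
  unfolding neg_def_mat_def
proof (intro conjI ballI impI)
  have RT: "transpose_mat R \<in> carrier_mat k m" using R by simp
  have RX: "transpose_mat R * X \<in> carrier_mat k m" using RT X by simp
  show "transpose_mat R * X * R \<in> carrier_mat k k" using RX R by simp
  show "transpose_mat (transpose_mat R * X * R) = transpose_mat R * X * R"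
    using transpose_mult[OF RX R] transpose_mult[OF RT X] XT assoc_mult_mat[OF RT X R] by simp
  fix w :: "real Matrix.vec" assume w: "w \<in> carrier_vec k" "w \<noteq> 0\<^sub>v k"
  have Rw: "R *\<^sub>v w \<in> carrier_vec m" using R w(1) by (rule mult_mat_vec_carrier)
  have XRw: "X *\<^sub>v (R *\<^sub>v w) \<in> carrier_vec m" using X Rw by (rule mult_mat_vec_carrier)
  have "(transpose_mat R * X * R) *\<^sub>v w = transpose_mat R *\<^sub>v (X *\<^sub>v (R *\<^sub>v w))"
    using assoc_mult_mat_vec[OF RX R w(1)] assoc_mult_mat_vec[OF RT X Rw] by simp
  then have "scalar_prod w ((transpose_mat R * X * R) *\<^sub>v w)
      = scalar_prod (transpose_mat R *\<^sub>v (X *\<^sub>v (R *\<^sub>v w))) w"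
    using comm_scalar_prod[OF w(1) mult_mat_vec_carrier[OF RT XRw]] by simp
  also have "\<dots> = scalar_prod (R *\<^sub>v w) (X *\<^sub>v (R *\<^sub>v w))"
    using transpose_vec_mult_scalar[OF R w(1) XRw] comm_scalar_prod[OF Rw XRw] by simp
  also have "\<dots> < 0" using neg w by blast
  finally show "scalar_prod w ((transpose_mat R * X * R) *\<^sub>v w) < 0" .
qed

section \<open>States spanned by the modes\<close>

text \<open>The function $\Phi_n^\top c$.\<close>

definition mode_sum :: "nat \<Rightarrow> (nat \<Rightarrow> real \<Rightarrow> real) \<Rightarrow> real Matrix.vec \<Rightarrow> real \<Rightarrow> real" where
  "mode_sum n \<phi> c \<theta> = (\<Sum>k<n. vec_index c k * \<phi> k \<theta>)"

text \<open>
  The state $(x, \Phi_n^\top c)$ of a stacked vector $(x, c)$: the first \<open>nx\<close> entries are the finite-dimensional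
  part, the last \<open>n\<close> are the coefficients of the modes.
\<close>

definition mode_state :: "nat \<Rightarrow> nat \<Rightarrow> (nat \<Rightarrow> real \<Rightarrow> real) \<Rightarrow> real Matrix.vec \<Rightarrow> state" where
  "mode_state nx n \<phi> v = (vec_first v nx, mode_sum n \<phi> (vec_last v n))"

lemma mode_state_append:
  assumes x: "x \<in> carrier_vec nx" and c: "c \<in> carrier_vec n"
  shows "mode_state nx n \<phi> (x @\<^sub>v c) = (x, mode_sum n \<phi> c)"
proof -
  have "vec_first (x @\<^sub>v c) nx = x" using x by (intro eq_vecI) (auto simp: vec_first_def)
  moreover have "vec_last (x @\<^sub>v c) n = c" using x c by (intro eq_vecI) (auto simp: vec_last_def)
  ultimately show ?thesis by (simp add: mode_state_def)
qed

lemma mode_sum_add: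
  "c \<in> carrier_vec n \<Longrightarrow> d \<in> carrier_vec n \<Longrightarrow>
    mode_sum n \<phi> (c + d) = (\<lambda>\<theta>. mode_sum n \<phi> c \<theta> + mode_sum n \<phi> d \<theta>)"
  by (auto simp: mode_sum_def algebra_simps sum.distrib)

lemma mode_sum_scale:
  "c \<in> carrier_vec n \<Longrightarrow> mode_sum n \<phi> (a \<cdot>\<^sub>v c) = (\<lambda>\<theta>. a * mode_sum n \<phi> c \<theta>)"
  by (auto simp: mode_sum_def algebra_simps sum_distrib_left)

lemma mode_sum_L2: "\<forall>k<n. \<phi> k \<in> L2 L \<Longrightarrow> mode_sum n \<phi> c \<in> L2 L"
  unfolding mode_sum_def[abs_def] by (intro L2_sum) auto

lemma mode_sum_norm:
  assumes L2: "\<forall>k<n. \<phi> k \<in> L2 L" and on: "L2_orthonormal L n \<phi>" and c: "c \<in> carrier_vec n"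
  shows "L2_inner L (mode_sum n \<phi> c) (mode_sum n \<phi> c) = scalar_prod c c"
proof -
  have int: "integrable (lebesgue_on {0<..<L}) (\<lambda>\<theta>. \<phi> j \<theta> * \<phi> k \<theta>)" if "j < n" "k < n" for j k
    using L2 that by (intro L2_prod_integrable) auto
  have "L2_inner L (mode_sum n \<phi> c) (mode_sum n \<phi> c) = (LINT \<theta>|lebesgue_on {0<..<L}.
      (\<Sum>j<n. \<Sum>k<n. vec_index c j * vec_index c k * (\<phi> j \<theta> * \<phi> k \<theta>)))"
    by (simp add: L2_inner_def mode_sum_def sum_product mult_ac)
  also have "\<dots> = (\<Sum>j<n. \<Sum>k<n. vec_index c j * vec_index c k * L2_inner L (\<phi> j) (\<phi> k))"
  proof -
    have "(LINT \<theta>|lebesgue_on {0<..<L}.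
          (\<Sum>j<n. \<Sum>k<n. vec_index c j * vec_index c k * (\<phi> j \<theta> * \<phi> k \<theta>)))
        = (\<Sum>j<n. LINT \<theta>|lebesgue_on {0<..<L}.
          (\<Sum>k<n. vec_index c j * vec_index c k * (\<phi> j \<theta> * \<phi> k \<theta>)))"
      by (intro Bochner_Integration.integral_sum Bochner_Integration.integrable_sum
          Bochner_Integration.integrable_mult_right int) auto
    also have "\<dots> = (\<Sum>j<n. \<Sum>k<n. LINT \<theta>|lebesgue_on {0<..<L}.
          vec_index c j * vec_index c k * (\<phi> j \<theta> * \<phi> k \<theta>))"
      by (intro sum.cong refl Bochner_Integration.integral_sum
          Bochner_Integration.integrable_mult_right int) auto
    finally show ?thesis by (simp add: L2_inner_def)
  qed
  also have "\<dots> = (\<Sum>j<n. \<Sum>k<n. if j = k then vec_index c j * vec_index c k else 0)"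
    using on by (intro sum.cong refl) (auto simp: L2_orthonormal_def)
  also have "\<dots> = scalar_prod c c"
    using c by (simp add: scalar_prod_def atLeast0LessThan)
  finally show ?thesis .
qed

lemma carrier_vec_append_obtain:
  assumes "v \<in> carrier_vec (nx + n)"
  obtains x c where "x \<in> carrier_vec nx" "c \<in> carrier_vec n" "v = x @\<^sub>v c"
  using vec_first_last_append[OF assms] that[of "vec_first v nx" "vec_last v n"] by simp

lemma append_vec_smult:
  "x \<in> carrier_vec nx \<Longrightarrow> c \<in> carrier_vec n \<Longrightarrow> a \<cdot>\<^sub>v (x @\<^sub>v c) = (a \<cdot>\<^sub>v x) @\<^sub>v (a \<cdot>\<^sub>v c)"
  by (intro eq_vecI) auto

lemma mode_state_in_Hspace:
  assumes "\<forall>k<n. \<phi> k \<in> L2 L" shows "mode_state nx n \<phi> v \<in> Hspace nx L"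
  using mode_sum_L2[OF assms] by (simp add: mode_state_def Hspace_def)

lemma mode_state_add:
  assumes v: "v \<in> carrier_vec (nx + n)" and w: "w \<in> carrier_vec (nx + n)"
  shows "mode_state nx n \<phi> (v + w) = Hadd (mode_state nx n \<phi> v) (mode_state nx n \<phi> w)"
proof -
  obtain x c where x: "x \<in> carrier_vec nx" "c \<in> carrier_vec n" "v = x @\<^sub>v c"
    using carrier_vec_append_obtain[OF v] .
  obtain y d where y: "y \<in> carrier_vec nx" "d \<in> carrier_vec n" "w = y @\<^sub>v d"
    using carrier_vec_append_obtain[OF w] .
  have "v + w = (x + y) @\<^sub>v (c + d)" unfolding x(3) y(3) by (rule append_vec_add) fact+
  then show ?thesis using x y by (simp add: mode_state_append Hadd_def mode_sum_add)
qed

lemma mode_state_scale: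
  assumes v: "v \<in> carrier_vec (nx + n)"
  shows "mode_state nx n \<phi> (a \<cdot>\<^sub>v v) = Hscale a (mode_state nx n \<phi> v)"
proof -
  obtain x c where x: "x \<in> carrier_vec nx" "c \<in> carrier_vec n" "v = x @\<^sub>v c"
    using carrier_vec_append_obtain[OF v] .
  then show ?thesis
    by (simp add: append_vec_smult mode_state_append Hscale_def mode_sum_scale)
qed

lemma mode_state_norm:
  assumes "\<forall>k<n. \<phi> k \<in> L2 L" "L2_orthonormal L n \<phi>" and v: "v \<in> carrier_vec (nx + n)"
  shows "Hinner L (mode_state nx n \<phi> v) (mode_state nx n \<phi> v) = scalar_prod v v"
proof -
  obtain x c where x: "x \<in> carrier_vec nx" "c \<in> carrier_vec n" "v = x @\<^sub>v c"
    using carrier_vec_append_obtain[OF v] .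
  then show ?thesis using assms
    by (simp add: mode_state_append Hinner_def mode_sum_norm scalar_prod_append[of _ nx _ n])
qed

section \<open>Membership in the domain of the system operator\<close>

lemma lebesgue_integral_open_interval:
  fixes f :: "real \<Rightarrow> real"
  assumes "continuous_on {a..b} f"
  shows "(LINT \<theta>|lebesgue_on {a<..<b}. f \<theta>) = integral {a..b} f"
proof -
  have "f absolutely_integrable_on {a<..<b}"
    by (rule set_integrable_subset[OF absolutely_integrable_continuous_real[OF assms]]) auto
  then have "integrable (lebesgue_on {a<..<b}) f" by (rule absolutely_integrable_imp_integrable) simp
  then show ?thesis
    using lebesgue_integral_eq_integral integral_open_interval_real[of a b f] by fastforce
qed

text \<open>
  A continuously differentiable function has its derivative as weak derivative. The boundary terms
  of the integration by parts vanish because the support of a test function avoids both endpoints.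
\<close>

lemma weak_derivI:
  fixes f f' :: "real \<Rightarrow> real"
  assumes L: "0 \<le> L" and f: "\<And>\<theta>. \<theta> \<in> {0..L} \<Longrightarrow> (f has_real_derivative f' \<theta>) (at \<theta> within {0..L})"
    and f': "continuous_on {0..L} f'"
  shows "weak_deriv L f f'"
  unfolding weak_deriv_def
proof (intro allI impI)
  fix \<psi> assume \<psi>: "test_function L \<psi>"
  have diff: "(deriv ^^ k) \<psi> differentiable_on UNIV" for k
    using \<psi> unfolding test_function_def by blast
  have d0: "\<psi> differentiable_on UNIV" and d1: "deriv \<psi> differentiable_on UNIV"
    using diff[of 0] diff[of 1] by simp_all
  have D: "(\<psi> has_real_derivative deriv \<psi> \<theta>) (at \<theta> within {0..L})" for \<theta>
    using d0 unfolding differentiable_on_def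
    by (auto simp: DERIV_deriv_iff_real_differentiable intro: has_field_derivative_at_within)
  have cont: "continuous_on {0..L} (deriv \<psi>)" "continuous_on {0..L} \<psi>"
    using d0 d1 by (auto intro: continuous_on_subset differentiable_imp_continuous_on)
  have contf: "continuous_on {0..L} f"
    by (rule DERIV_continuous_on) (rule f)
  have zero: "\<psi> \<theta> = 0" if "\<theta> \<notin> {0<..<L}" for \<theta>
    using \<psi> that closure_subset[of "{\<theta>. \<psi> \<theta> \<noteq> 0}"] unfolding test_function_def by blast
  have "((\<lambda>\<theta>. f' \<theta> * \<psi> \<theta> + f \<theta> * deriv \<psi> \<theta>) has_integral (f L * \<psi> L - f 0 * \<psi> 0)) {0..L}"
  proof (rule fundamental_theorem_of_calculus[OF L])
    fix \<theta> assume "\<theta> \<in> {0..L}"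
    from DERIV_mult'[OF f[OF this] D[of \<theta>]]
    show "((\<lambda>\<theta>. f \<theta> * \<psi> \<theta>) has_vector_derivative f' \<theta> * \<psi> \<theta> + f \<theta> * deriv \<psi> \<theta>)
        (at \<theta> within {0..L})"
      by (simp add: has_real_derivative_iff_has_vector_derivative add.commute)
  qed
  then have "integral {0..L} (\<lambda>\<theta>. f' \<theta> * \<psi> \<theta> + f \<theta> * deriv \<psi> \<theta>) = 0"
    by (simp add: zero integral_unique)
  also have "integral {0..L} (\<lambda>\<theta>. f' \<theta> * \<psi> \<theta> + f \<theta> * deriv \<psi> \<theta>)
      = integral {0..L} (\<lambda>\<theta>. f' \<theta> * \<psi> \<theta>) + integral {0..L} (\<lambda>\<theta>. f \<theta> * deriv \<psi> \<theta>)"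
    by (intro integral_add integrable_continuous_real continuous_intros cont contf f')
  finally show "L2_inner L f (deriv \<psi>) = - L2_inner L f' \<psi>"
    unfolding L2_inner_def
    by (subst (1 2) lebesgue_integral_open_interval) (auto intro!: continuous_intros cont contf f')
qed

context
  fixes n :: nat and \<phi> :: "nat \<Rightarrow> real \<Rightarrow> real" and \<Delta> :: "real Matrix.mat" and L :: real
  assumes L: "L > 0" and D: "\<Delta> \<in> carrier_mat n n" and L2: "\<forall>k<n. \<phi> k \<in> L2 L"
    and closed_deriv: "\<forall>\<theta>\<in>{0..L}. \<forall>k<n.
           (\<phi> k has_real_derivative (\<Delta> * Phi n \<phi> \<theta>) $$ (k, 0)) (at \<theta> within {0..L})"
begin

lemma mode_sum_deriv:
  assumes c: "c \<in> carrier_vec n" and \<theta>: "\<theta> \<in> {0..L}"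
  shows "(mode_sum n \<phi> c has_real_derivative mode_sum n \<phi> (transpose_mat \<Delta> *\<^sub>v c) \<theta>) (at \<theta> within {0..L})"
proof -
  have "(mode_sum n \<phi> c has_real_derivative
      (\<Sum>k<n. vec_index c k * (\<Delta> * Phi n \<phi> \<theta>) $$ (k, 0))) (at \<theta> within {0..L})"
    unfolding mode_sum_def[abs_def] using closed_deriv \<theta>
    by (intro DERIV_sum DERIV_cmult) auto
  also have "(\<Sum>k<n. vec_index c k * (\<Delta> * Phi n \<phi> \<theta>) $$ (k, 0))
      = (\<Sum>k<n. \<Sum>j<n. vec_index c k * (\<Delta> $$ (k, j) * \<phi> j \<theta>))"
    using D by (intro sum.cong refl)
      (simp add: Phi_def scalar_prod_def atLeast0LessThan sum_distrib_left)
  also have "\<dots> = (\<Sum>j<n. \<Sum>k<n. vec_index c k * (\<Delta> $$ (k, j) * \<phi> j \<theta>))"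
    by (rule sum.swap)
  also have "\<dots> = mode_sum n \<phi> (transpose_mat \<Delta> *\<^sub>v c) \<theta>"
    unfolding mode_sum_def using D c by (intro sum.cong refl)
      (simp add: scalar_prod_def atLeast0LessThan sum_distrib_left sum_distrib_right mult_ac)
  finally show ?thesis .
qed

lemma mode_sum_continuous: "c \<in> carrier_vec n \<Longrightarrow> continuous_on {0..L} (mode_sum n \<phi> c)"
  by (rule DERIV_continuous_on) (rule mode_sum_deriv)

lemma mode_sum_H2:
  assumes c: "c \<in> carrier_vec n"
  shows "has_H2_derivs L (mode_sum n \<phi> c) (mode_sum n \<phi> (transpose_mat \<Delta> *\<^sub>v c))
    (mode_sum n \<phi> (transpose_mat \<Delta> *\<^sub>v (transpose_mat \<Delta> *\<^sub>v c)))"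
proof -
  have DT: "transpose_mat \<Delta> \<in> carrier_mat n n" using D by simp
  have c1: "transpose_mat \<Delta> *\<^sub>v c \<in> carrier_vec n" using DT c by (rule mult_mat_vec_carrier)
  have c2: "transpose_mat \<Delta> *\<^sub>v (transpose_mat \<Delta> *\<^sub>v c) \<in> carrier_vec n"
    using DT c1 by (rule mult_mat_vec_carrier)
  show ?thesis
    unfolding has_H2_derivs_def using L
    by (intro conjI mode_sum_L2[OF L2] weak_derivI mode_sum_deriv mode_sum_continuous c c1 c2) auto
qed

text \<open>The mode sums are continuous on \<open>[0, L]\<close>, so they are their own continuous representatives.\<close>

lemma mode_sum_has_value:
  "c \<in> carrier_vec n \<Longrightarrow> has_value L (mode_sum n \<phi> c) \<theta> (mode_sum n \<phi> c \<theta>)"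
  unfolding has_value_def L2_eq_def using mode_sum_continuous by blast

lemma mode_sum_eq_Phi:
  "c \<in> carrier_vec n \<Longrightarrow> transpose_mat (Phi n \<phi> \<theta>) *\<^sub>v c = Matrix.vec 1 (\<lambda>_. mode_sum n \<phi> c \<theta>)"
  by (intro eq_vecI) (auto simp: Phi_def mode_sum_def scalar_prod_def atLeast0LessThan mult.commute)

text \<open>
  The system operator maps the mode states in its domain to mode states, and acts on their coordinates by
  the linear map of \<open>Psi_minus_quadratic_form\<close>. The two rows of the boundary matrix express
  $z(0) = Cx$ and $z(L) = 0$.
\<close>

lemma mode_state_in_domain:
  assumes A: "A \<in> carrier_mat nx nx" and B: "B \<in> carrier_mat nx 1" and C: "C \<in> carrier_mat 1 nx"
    and x: "x \<in> carrier_vec nx" and c: "c \<in> carrier_vec n"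
    and kernel: "boundary_mat nx C (Phi n \<phi> 0) (Phi n \<phi> L) *\<^sub>v (x @\<^sub>v c) = 0\<^sub>v 2"
  defines "c1 \<equiv> transpose_mat \<Delta> *\<^sub>v c"
  defines "c2 \<equiv> transpose_mat \<Delta> *\<^sub>v c1"
  shows "(mode_state nx n \<phi> (x @\<^sub>v c),
      mode_state nx n \<phi> ((A *\<^sub>v x + B *\<^sub>v (transpose_mat (Phi n \<phi> \<theta>o) *\<^sub>v c1))
        @\<^sub>v (lam \<cdot>\<^sub>v c + \<nu> \<cdot>\<^sub>v c2)))
    \<in> system_operator nx A B C lam \<nu> L \<theta>o"
proof -
  have DT: "transpose_mat \<Delta> \<in> carrier_mat n n" using D by simp
  have c1: "c1 \<in> carrier_vec n" unfolding c1_def using DT c by (rule mult_mat_vec_carrier)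
  have c2: "c2 \<in> carrier_vec n" unfolding c2_def using DT c1 by (rule mult_mat_vec_carrier)
  have Phi: "transpose_mat (Phi n \<phi> \<theta>) \<in> carrier_mat 1 n" for \<theta> by (simp add: Phi_def)
  let ?K = "boundary_mat nx C (Phi n \<phi> 0) (Phi n \<phi> L)"
  have neg: "(- transpose_mat (Phi n \<phi> \<theta>)) *\<^sub>v c = Matrix.vec 1 (\<lambda>_. - mode_sum n \<phi> c \<theta>)" for \<theta>
    using c by (intro eq_vecI)
      (auto simp: Phi_def mode_sum_def scalar_prod_def atLeast0LessThan mult.commute sum_negf)
  have "?K *\<^sub>v (x @\<^sub>v c) = (C *\<^sub>v x + (- transpose_mat (Phi n \<phi> 0)) *\<^sub>v c)
      @\<^sub>v (0\<^sub>m 1 nx *\<^sub>v x + (- transpose_mat (Phi n \<phi> L)) *\<^sub>v c)"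
    unfolding boundary_mat_def using C Phi x c by (intro four_block_mat_mult_vec) auto
  then have K: "(C *\<^sub>v x + Matrix.vec 1 (\<lambda>_. - mode_sum n \<phi> c 0))
      @\<^sub>v (0\<^sub>m 1 nx *\<^sub>v x + Matrix.vec 1 (\<lambda>_. - mode_sum n \<phi> c L)) = 0\<^sub>v 2"
    using kernel by (simp only: neg)
  have z0: "mode_sum n \<phi> c 0 = vec_index (C *\<^sub>v x) 0"
    using arg_cong[OF K, of "\<lambda>v. vec_index v 0"] C by simp
  have zL: "mode_sum n \<phi> c L = 0"
    using arg_cong[OF K, of "\<lambda>v. vec_index v 1"] C x by simp
  define d where "d = mode_sum n \<phi> c1 \<theta>o"
  have Bd: "B *\<^sub>v (transpose_mat (Phi n \<phi> \<theta>o) *\<^sub>v c1) = d \<cdot>\<^sub>v Matrix.col B 0"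
    unfolding mode_sum_eq_Phi[OF c1] d_def using B
    by (intro eq_vecI) (auto simp: scalar_prod_def)
  have y: "A *\<^sub>v x + d \<cdot>\<^sub>v Matrix.col B 0 \<in> carrier_vec nx" using A B x by auto
  have w: "lam \<cdot>\<^sub>v c + \<nu> \<cdot>\<^sub>v c2 \<in> carrier_vec n" using c c2 by simp
  have eq: "mode_sum n \<phi> (lam \<cdot>\<^sub>v c + \<nu> \<cdot>\<^sub>v c2) = (\<lambda>\<theta>. \<nu> * mode_sum n \<phi> c2 \<theta> + lam * mode_sum n \<phi> c \<theta>)"
    using c c2 by (simp add: mode_sum_add mode_sum_scale add.commute)
  have "has_H2_derivs L (mode_sum n \<phi> c) (mode_sum n \<phi> c1) (mode_sum n \<phi> c2) \<and>
      has_value L (mode_sum n \<phi> c) 0 (vec_index (C *\<^sub>v x) 0) \<and> has_value L (mode_sum n \<phi> c) L 0 \<and>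
      has_value L (mode_sum n \<phi> c1) \<theta>o d \<and>
      A *\<^sub>v x + d \<cdot>\<^sub>v Matrix.col B 0 = A *\<^sub>v x + d \<cdot>\<^sub>v Matrix.col B 0 \<and>
      L2_eq L (mode_sum n \<phi> (lam \<cdot>\<^sub>v c + \<nu> \<cdot>\<^sub>v c2)) (\<lambda>\<theta>. \<nu> * mode_sum n \<phi> c2 \<theta> + lam * mode_sum n \<phi> c \<theta>)"
    using mode_sum_H2[OF c, folded c1_def, folded c2_def] mode_sum_has_value[OF c, of 0] mode_sum_has_value[OF c, of L]
      mode_sum_has_value[OF c1, of \<theta>o] z0 zL
    unfolding eq d_def by (simp add: L2_eq_def)
  then show ?thesis
    unfolding Bd mode_state_append[OF x c] mode_state_append[OF y w] system_operator_def
    using x mode_sum_L2[OF L2] by blast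
qed

end

section \<open>Infeasibility implies instability\<close>

theorem theorem3:
  fixes nx n :: nat
    and A B C \<Delta> \<Pi>n :: "real Matrix.mat"
    and lam \<nu> \<theta>i \<theta>o :: real
    and \<phi> :: "nat \<Rightarrow> real \<Rightarrow> real"
    and \<T> :: "real \<Rightarrow> state \<Rightarrow> state"
  assumes "nx \<ge> 1"
    and "A \<in> carrier_mat nx nx" and "B \<in> carrier_mat nx 1" and "C \<in> carrier_mat 1 nx"
    and "\<nu> > 0" and "\<theta>i > 0" and "\<theta>o \<in> {0..\<theta>i}"
    and semigroup: "generates nx \<theta>i (system_operator nx A B C lam \<nu> \<theta>i \<theta>o) \<T>"
    and "\<forall>k<n. \<phi> k \<in> L2 \<theta>i"
    and "L2_lin_indep \<theta>i n \<phi>"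
    and "L2_orthonormal \<theta>i n \<phi>"
    and "\<Delta> \<in> carrier_mat n n"
    and closed_deriv: "\<forall>\<theta>\<in>{0..\<theta>i}. \<forall>k<n.
           (\<phi> k has_real_derivative (\<Delta> * Phi n \<phi> \<theta>) $$ (k, 0)) (at \<theta> within {0..\<theta>i})"
    and "kernel_basis_mat (nx + n) (boundary_mat nx C (Phi n \<phi> 0) (Phi n \<phi> \<theta>i)) \<Pi>n"
    and no_triplet: "\<not> (\<exists>P Q Tn. pos_def_mat nx P \<and> Q \<in> carrier_mat nx n \<and> pos_def_mat n Tn \<and>
           pos_def_mat (nx + n) (Psi_plus P Q Tn) \<and>
           neg_def_mat (dim_col \<Pi>n)
             (transpose_mat \<Pi>n * Psi_minus nx n A B lam \<nu> \<Delta> (Phi n \<phi> \<theta>o) P Q Tn * \<Pi>n))"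
  shows "unstable nx \<theta>i \<T>"
proof
  assume gas: "globally_asymptotically_stable nx \<theta>i \<T>"
  let ?N = "nx + n" and ?G = "system_operator nx A B C lam \<nu> \<theta>i \<theta>o"
    and ?K = "boundary_mat nx C (Phi n \<phi> 0) (Phi n \<phi> \<theta>i)"
  let ?E = "mode_state nx n \<phi>"
  have C0: "C0_semigroup nx \<theta>i \<T>" using semigroup unfolding generates_def by blast
  obtain M where "bounded_semigroup nx \<theta>i \<T> M"
    using globally_asymptotically_stable_bound[OF C0 gas] .
  then interpret bounded_semigroup nx \<theta>i \<T> M .
  interpret state_embedding nx \<theta>i \<T> M ?N ?E
    by unfold_locales
      (simp_all add: mode_state_in_Hspace mode_state_add mode_state_scale mode_state_norm
        \<open>\<forall>k<n. \<phi> k \<in> L2 \<theta>i\<close> \<open>L2_orthonormal \<theta>i n \<phi>\<close>)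
  have decay: "((\<lambda>t. Hnorm \<theta>i (\<T> t h)) \<longlongrightarrow> 0) at_top" if "h \<in> Hspace nx \<theta>i" for h
    using gas that unfolding globally_asymptotically_stable_def by simp
  obtain T where T: "T > 0"
    and contract: "\<And>v. v \<in> carrier_vec ?N \<Longrightarrow> v \<noteq> 0\<^sub>v ?N \<Longrightarrow>
      gram T (?E v) (?E v) < scalar_prod v v"
    using eventually_contractive[OF decay] by blast
  obtain P Q Tn where P: "pos_def_mat nx P" and Q: "Q \<in> carrier_mat nx n" and Tn: "pos_def_mat n Tn"
    and V: "energy_mat T = Psi_plus P Q Tn"
    using pos_def_mat_blocks[OF energy_mat_pos_def[OF T]] .
  let ?Psi = "Psi_minus nx n A B lam \<nu> \<Delta> (Phi n \<phi> \<theta>o) P Q Tn"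
  have Pc: "P \<in> carrier_mat nx nx" and Tc: "Tn \<in> carrier_mat n n"
    using P Tn unfolding pos_def_mat_def by blast+
  note Psi = Psi_minus_carrier_symmetric[OF \<open>A \<in> carrier_mat nx nx\<close> \<open>\<Delta> \<in> carrier_mat n n\<close> Pc Tc]
  have K: "?K \<in> carrier_mat 2 ?N"
  proof -
    have "?K \<in> carrier_mat (1 + 1) ?N"
      unfolding boundary_mat_def using \<open>C \<in> carrier_mat 1 nx\<close>
      by (intro four_block_carrier_mat) (auto simp: Phi_def)
    then show ?thesis by (simp only: one_add_one)
  qed
  have "neg_def_mat (dim_col \<Pi>n) (transpose_mat \<Pi>n * ?Psi * \<Pi>n)"
  proof (rule neg_def_mat_congruence[OF Psi])
    show "\<Pi>n \<in> carrier_mat ?N (dim_col \<Pi>n)"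
      using \<open>kernel_basis_mat ?N ?K \<Pi>n\<close> unfolding kernel_basis_mat_def by blast
    fix w :: "real Matrix.vec" assume w: "w \<in> carrier_vec (dim_col \<Pi>n)" "w \<noteq> 0\<^sub>v (dim_col \<Pi>n)"
    define v where "v = \<Pi>n *\<^sub>v w"
    have v: "v \<in> carrier_vec ?N" "v \<noteq> 0\<^sub>v ?N" and Kv: "?K *\<^sub>v v = 0\<^sub>v 2"
      unfolding v_def using kernel_basis_mat_mult[OF \<open>kernel_basis_mat ?N ?K \<Pi>n\<close> K w] by blast+
    obtain x c where x: "x \<in> carrier_vec nx" and c: "c \<in> carrier_vec n" and vx: "v = x @\<^sub>v c"
      using carrier_vec_append_obtain[OF v(1)] .
    let ?c1 = "transpose_mat \<Delta> *\<^sub>v c"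
    let ?c2 = "transpose_mat \<Delta> *\<^sub>v ?c1"
    let ?y = "A *\<^sub>v x + B *\<^sub>v (transpose_mat (Phi n \<phi> \<theta>o) *\<^sub>v ?c1)"
    let ?u = "?y @\<^sub>v (lam \<cdot>\<^sub>v c + \<nu> \<cdot>\<^sub>v ?c2)"
    have DT: "transpose_mat \<Delta> \<in> carrier_mat n n" using \<open>\<Delta> \<in> carrier_mat n n\<close> by simp
    have c1: "?c1 \<in> carrier_vec n" using DT c by (rule mult_mat_vec_carrier)
    have c2: "?c2 \<in> carrier_vec n" using DT c1 by (rule mult_mat_vec_carrier)
    have "transpose_mat (Phi n \<phi> \<theta>o) \<in> carrier_mat 1 n" by (simp add: Phi_def)
    then have p: "transpose_mat (Phi n \<phi> \<theta>o) *\<^sub>v ?c1 \<in> carrier_vec 1"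
      using c1 by (rule mult_mat_vec_carrier)
    have "?y \<in> carrier_vec nx"
      using mult_mat_vec_carrier[OF \<open>A \<in> carrier_mat nx nx\<close> x]
        mult_mat_vec_carrier[OF \<open>B \<in> carrier_mat nx 1\<close> p] by simp
    then have u: "?u \<in> carrier_vec ?N" using c c2 by (intro append_carrier_vec) auto
    have "(?E v, ?E ?u) \<in> ?G"
      unfolding vx
      by (rule mode_state_in_domain[OF \<open>\<theta>i > 0\<close> \<open>\<Delta> \<in> carrier_mat n n\<close> \<open>\<forall>k<n. \<phi> k \<in> L2 \<theta>i\<close>
            closed_deriv \<open>A \<in> carrier_mat nx nx\<close> \<open>B \<in> carrier_mat nx 1\<close> \<open>C \<in> carrier_mat 1 nx\<close>
            x c Kv[unfolded vx]])
    then have "2 * scalar_prod v (energy_mat T *\<^sub>v ?u) = gram T (?E v) (?E v) - scalar_prod v v"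
      using semigroup T v(1) u by (intro energy_mat_derivative) auto
    moreover have "scalar_prod v (?Psi *\<^sub>v v) = 2 * scalar_prod v (energy_mat T *\<^sub>v ?u)"
      unfolding V vx using \<open>A \<in> carrier_mat nx nx\<close> \<open>B \<in> carrier_mat nx 1\<close> \<open>\<Delta> \<in> carrier_mat n n\<close> _ Pc Q Tc x c
      by (rule Psi_minus_quadratic_form) (simp add: Phi_def)
    ultimately show "scalar_prod (\<Pi>n *\<^sub>v w) (?Psi *\<^sub>v (\<Pi>n *\<^sub>v w)) < 0"
      using contract[OF v] unfolding v_def by linarith
  qed
  moreover have "pos_def_mat ?N (Psi_plus P Q Tn)" using energy_mat_pos_def[OF T] unfolding V .
  ultimately show False using no_triplet P Q Tn by blast
qed

end
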